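(* Fix $h\in(0,1)$ and $\Delta t\in(0,1)$ with $\Delta t\approx h$. Let $\{\widetilde{\mathbf U}_h^n\}_{n=1}^\infty$ be a sequence of discrete solutions of the Navier–Stokes–Fourier system (defined through the finite volume scheme in the context) on the time intervals $[T_n,\infty)$, where $T_n\to-\infty$. Suppose that $\widetilde{\mathbf U}_h^n=(\widetilde\varrho,\widetilde{\mathbf u},\widetilde\vartheta)_h^n$ satisfy the boundedness hypothesis with the same bounds for all $n$: there are positive constants $\underline\varrho,\overline\varrho,\underline\vartheta,\overline\vartheta,\overline u$, independent of $n$ and $t$, such that $$\underline\varrho\le\widetilde\varrho_h^n(t,x)\le\overline\varrho,\qquad \underline\vartheta\le\widetilde\vartheta_h^n(t,x)\le\overline\vartheta,\qquad |\widetilde{\mathbf u}_h^n(t,x)|\le\overline u$$ for all $n$, all $t\in[T_n,\infty)$ and a.e. $x\in\Omega$. Then there exists a subsequence $\{\widetilde{\mathbf U}_h^{n_m}\}_{m=1}^\infty$ such that $$\widetilde{\mathbf U}_h^{n_m}\to\widetilde{\mathbf U}_h^\infty\quad\text{in } C_{\rm loc}(\mathbb R;Q_h^{d+2})\ \text{ as } m\to\infty$$ (i.e. uniformly on every compact time interval, which is contained in $[T_{n_m},\infty)$ for all large $m$), where $\widetilde{\mathbf U}_h^\infty$ is an entire discrete solution.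
   Context: **Domain and data.** $d\in\{2,3\}$, $L,H>0$, $\Omega=\mathbb T^{d-1}\times[-H,H]$, $\mathbb T^{d-1}=([-L,L]|_{\{-L,L\}})^{d-1}$ (periodic in the first $d-1$ directions), so $\partial\Omega=\{x_d=\pm H\}$. $\mu,\eta,\kappa$ are fixed constants (viscosities and heat conductivity), $\lambda=\eta-\frac2d\mu$, $c_v=\frac1{\gamma-1}$ with $\gamma>1$, $p=\varrho\vartheta$. $G=G(x)\in C^1(\overline\Omega)$ is the gravitational potential with $\nabla_xG\cdot\mathbf n|_{\partial\Omega}$ constant. $\vartheta_{B,h}$ is a given discrete boundary temperature, constant on each exterior face. **Mesh.** $\Omega$ is divided into uniform cubes (squares if $d=2$) $K\in\mathcal T_h$ of side $h\in(0,1)$. $Q_h$ is the space of functions piecewise constant on $\mathcal T_h$. $\mathcal E$ is the set of all faces, $\mathcal E_{\rm ext}=\mathcal E\cap\partial\Omega$, $\mathcal E_{\rm int}=\mathcal E\setminus\mathcal E_{\rm ext}$, $\mathcal E(K)$ the set of faces of $K$; $\int_{\mathcal E_{\rm int}}$, $\int_{\mathcal E_{\rm ext}}$ denote sums of the surface integrals over the corresponding faces. On a face with unit normal $\mathbf n$ (outer normal on exterior faces), $v^{\rm in}=\lim_{\delta\to0+}v(x-\delta\mathbf n)$, $v^{\rm out}=\lim_{\delta\to0+}v(x+\delta\mathbf n)$, $[[v]]=v^{\rm out}-v^{\rm in}$, $\{\{v\}\}=\frac12(v^{\rm in}+v^{\rm out})$. On exterior faces the exterior traces of the discrete solution are fixed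 by the boundary conditions $\{\{\vartheta_h\}\}_\sigma=\vartheta_{B,h}$, $\{\{\mathbf u_h\}\}_\sigma=0$, $\sigma\in\mathcal E_{\rm ext}$. Discrete operators ($\mathbf n$ is the outer normal to $K$ in the sums): $$\nabla_hv=\frac1h\sum_{K}\mathbf 1_K\sum_{\sigma\in\mathcal E(K)}\mathbf n\{\{v\}\},\qquad {\rm div}_h\mathbf v=\frac1h\sum_K\mathbf 1_K\sum_{\sigma\in\mathcal E(K)}\mathbf n\cdot\{\{\mathbf v\}\},\qquad \mathbb D_h\mathbf v=\tfrac12(\nabla_h\mathbf v+\nabla_h^T\mathbf v),$$ with $\nabla_h$ acting componentwise on vectors. The diffusive upwind flux is $$F_h^\alpha(r_h,\mathbf u_h)=r_h^{\rm up}\{\{\mathbf u_h\}\}\cdot\mathbf n-h^\alpha[[r_h]],\quad \alpha>-1,\qquad r_h^{\rm up}=\begin{cases}r_h^{\rm in}&\text{if }\{\{\mathbf u_h\}\}\cdot\mathbf n\ge0,\\ r_h^{\rm out}&\text{if }\{\{\mathbf u_h\}\}\cdot\mathbf n<0,\end{cases}$$ and $\mathbf F_h^\alpha$ is its componentwise version for vectors. Write $D_tv_h^k=(v_h^k-v_h^{k-1})/\Delta t$, $\mathbb S_h=2\mu\mathbb D_h\mathbf u_h+\lambda\,{\rm div}_h\mathbf u_h\,\mathbb I$, $p_h=\varrho_h\vartheta_h$. **Scheme.** Given $\mathbf U_h^{k-1}=(\varrho_h^{k-1},\mathbf u_h^{k-1},\vartheta_h^{k-1})\in Q_h^{d+2}$,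 $\mathbf U_h^k=(\varrho_h^k,\mathbf u_h^k,\vartheta_h^k)\in Q_h^{d+2}$ is a solution of $$\int_\Omega D_t\varrho_h^k\phi_h\,dx-\int_{\mathcal E_{\rm int}}F_h^\alpha(\varrho_h^k,\mathbf u_h^k)[[\phi_h]]\,dS_x=0\quad\forall\phi_h\in Q_h;$$ $$\int_\Omega D_t(\varrho_h^k\mathbf u_h^k)\cdot\boldsymbol\varphi_h\,dx-\int_{\mathcal E_{\rm int}}\mathbf F_h^\alpha(\varrho_h^k\mathbf u_h^k,\mathbf u_h^k)\cdot[[\boldsymbol\varphi_h]]\,dS_x+\int_\Omega(\mathbb S_h^k-p_h^k\mathbb I):\mathbb D_h\boldsymbol\varphi_h\,dx=\int_\Omega\varrho_h^k\nabla_xG\cdot\boldsymbol\varphi_h\,dx$$ for all $\boldsymbol\varphi_h\in Q_h^d$ with $\{\{\boldsymbol\varphi_h\}\}_\sigma=0$ for $\sigma\in\mathcal E_{\rm ext}$ (this fixes the exterior traces of $\boldsymbol\varphi_h$); $$c_v\int_\Omega D_t(\varrho_h^k\vartheta_h^k)\phi_h\,dx-c_v\int_{\mathcal E_{\rm int}}F_h^\alpha(\varrho_h^k\vartheta_h^k,\mathbf u_h^k)[[\phi_h]]\,dS_x+\int_{\mathcal E_{\rm int}}\frac\kappa h[[\vartheta_h^k]][[\phi_h]]\,dS_x$$ $$+2\int_{\mathcal E_{\rm ext}}\frac\kappa h\big((\vartheta_h^k)^{\rm in}-\vartheta_{B,h}\big)\phi_h^{\rm in}\,dS_x=\int_\Omega(\mathbb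 S_h^k-p_h^k\mathbb I):\nabla_h\mathbf u_h^k\,\phi_h\,dx\quad\forall\phi_h\in Q_h.$$ **Discrete solution on $[T,\infty)$.** A function $\widetilde{\mathbf U}_h=(\widetilde\varrho,\widetilde{\mathbf u},\widetilde\vartheta)_h$ on $[T,\infty)\times\Omega$ which is the piecewise linear (in time) interpolation, with nodes $T+k\Delta t$, $k=0,1,\dots$, of a sequence of values $\widetilde{\mathbf U}_h(T+k\Delta t,\cdot)\in Q_h^{d+2}$ such that consecutive values satisfy the scheme. **Entire discrete solution.** A function $\widetilde{\mathbf U}_h\in C(\mathbb R;Q_h^{d+2})$ for which there exists $\tau\in\mathbb R$ such that $\widetilde{\mathbf U}_h$ is a discrete solution on $[\tau-n\Delta t,\infty)$ for every $n=0,1,\dots$. *)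

theory Defs
  imports "HOL-Analysis.Analysis"
begin

text \<open>
  Points of the domain are vectors of type real ^ 'd, with d = CARD('d).  The index z is the
  coordinate written x_d on paper: the domain is [-H,H] in direction z and
  periodic with period 2L in all other directions.  A function on the domain is a function on
  real ^ 'd that is 2L-periodic in the directions other than z, so that traces on the faces
  x_j = -L, j different from z, are ordinary one-sided limits.
\<close>

context
  fixes L H :: real and z :: "'d::finite"
begin

definition lo :: "real ^ 'd" where
  "lo = (\<chi> i. if i = z then - H else - L)"

definition hi :: "real ^ 'd" where
  "hi = (\<chi> i. if i = z then H else L)"

definition Omega :: "(real ^ 'd) set" where
  "Omega = cbox lo hi"

definition periodic :: "(real ^ 'd \<Rightarrow> 'b) \<Rightarrow> bool" where
  "periodic f \<longleftrightarrow> (\<forall>j x. j \<noteq> z \<longrightarrow> f (x + (2 * L) *\<^sub>R axis j 1) = f x)"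

definition strip :: "(real ^ 'd) set" where
  "strip = {x. - H \<le> x $ z \<and> x $ z \<le> H}"

definition gradient :: "(real ^ 'd \<Rightarrow> real) \<Rightarrow> real ^ 'd \<Rightarrow> real ^ 'd" where
  "gradient G x = (\<chi> i. frechet_derivative G (at x within strip) (axis i 1))"

text \<open>C1 up to the boundary: derivatives at x_z = H and x_z = -H are taken within the strip.\<close>

definition C1_potential :: "(real ^ 'd \<Rightarrow> real) \<Rightarrow> bool" where
  "C1_potential G \<longleftrightarrow>
     (\<forall>x\<in>strip. \<forall>j. j \<noteq> z \<longrightarrow> G (x + (2 * L) *\<^sub>R axis j 1) = G x) \<and>
     G differentiable_on strip \<and> continuous_on strip (gradient G)"

definition outer_normal :: "real ^ 'd \<Rightarrow> real ^ 'd" where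
  "outer_normal x = sgn (x $ z) *\<^sub>R axis z 1"

definition normal_gradient_constant :: "(real ^ 'd \<Rightarrow> real) \<Rightarrow> bool" where
  "normal_gradient_constant G \<longleftrightarrow>
     (\<exists>g. \<forall>x. \<bar>x $ z\<bar> = H \<longrightarrow> gradient G x \<bullet> outer_normal x = g)"

end


subsection \<open>Mesh and discrete function space\<close>

context
  fixes L H h :: real and z :: "'d::finite"
begin

text \<open>The cubes of side h tile the domain exactly.\<close>

definition admissible_mesh :: bool where
  "admissible_mesh \<longleftrightarrow>
     (\<exists>N::nat. 2 * L = real N * h) \<and> (\<exists>M::nat. 2 * H = real M * h)"

definition grid :: "(real ^ 'd) set" where
  "grid = {c. \<forall>i. \<exists>k::int. c $ i = lo L H z $ i + of_int k * h}"

text \<open>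
  A cell is the half-open cube above its lowest corner; the cells partition the
  domain up to the null set x_z = H.
\<close>

definition cell :: "real ^ 'd \<Rightarrow> (real ^ 'd) set" where
  "cell c = {x. \<forall>i. c $ i \<le> x $ i \<and> x $ i < c $ i + h}"

definition cell_corners :: "(real ^ 'd) set" where
  "cell_corners = {c \<in> grid. \<forall>i. lo L H z $ i \<le> c $ i \<and> c $ i < hi L H z $ i}"

text \<open>
  The space Q_h with values in a vector space 'b.  The value 0 for x_z outside [-H,H) selects
  one representative per class of almost everywhere equal functions.
\<close>

definition Qh :: "(real ^ 'd \<Rightarrow> 'b::zero) set" where
  "Qh = {v. (\<forall>c\<in>cell_corners. v constant_on cell c) \<and> periodic L z v \<and>
            (\<forall>x. x $ z < - H \<or> H \<le> x $ z \<longrightarrow> v x = 0)}"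

text \<open>
  The pair (c, j) stands for the face with lowest corner c orthogonal to direction j.
  Faces identified by periodicity are listed once.
\<close>

definition face :: "(real ^ 'd) \<times> 'd \<Rightarrow> (real ^ 'd) set" where
  "face = (\<lambda>(c, j). {x. x $ j = c $ j \<and> (\<forall>i. i \<noteq> j \<longrightarrow> c $ i \<le> x $ i \<and> x $ i < c $ i + h)})"

definition faces :: "((real ^ 'd) \<times> 'd) set" where
  "faces = {(c, j). c \<in> grid \<and>
     (\<forall>i. lo L H z $ i \<le> c $ i \<and> (c $ i < hi L H z $ i \<or> (i = z \<and> j = z \<and> c $ z = H)))}"

definition ext_faces :: "((real ^ 'd) \<times> 'd) set" where
  "ext_faces = {(c, j) \<in> faces. j = z \<and> \<bar>c $ z\<bar> = H}"

definition int_faces :: "((real ^ 'd) \<times> 'd) set" where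
  "int_faces = faces - ext_faces"

text \<open>
  Surface integral over the face (c, j): the cube above c is the product of the face with an
  interval of length h in direction j, and the integrand below does not depend on that direction.
\<close>

definition face_integral :: "(real ^ 'd) \<times> 'd \<Rightarrow> (real ^ 'd \<Rightarrow> real) \<Rightarrow> real" where
  "face_integral = (\<lambda>(c, j) f.
     (1 / h) * (LINT x:cell c|lborel. f (\<chi> i. if i = j then c $ j else x $ i)))"

text \<open>
  Integral over the interior faces of an expression f n x containing the unit normal n.  The
  normal is the positive coordinate direction; all integrands used are even in n.
\<close>

definition int_face_integral :: "(real ^ 'd \<Rightarrow> real ^ 'd \<Rightarrow> real) \<Rightarrow> real" where
  "int_face_integral f = (\<Sum>(c, j)\<in>int_faces. face_integral (c, j) (f (axis j 1)))"

definition ext_face_integral :: "(real ^ 'd \<Rightarrow> real ^ 'd \<Rightarrow> real) \<Rightarrow> real" where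
  "ext_face_integral f =
     (\<Sum>(c, j)\<in>ext_faces. face_integral (c, j) (f (outer_normal z c)))"


subsection \<open>Discrete operators\<close>

definition trace_in :: "real ^ 'd \<Rightarrow> (real ^ 'd \<Rightarrow> 'b::real_normed_vector) \<Rightarrow> real ^ 'd \<Rightarrow> 'b" where
  "trace_in n v x = Lim (at_right 0) (\<lambda>\<delta>. v (x - \<delta> *\<^sub>R n))"

text \<open>
  The condition on n and x says that x lies on the boundary and n is the outer normal
  there.  The exterior trace is then the one given by {{v}} = 0, the boundary condition of the
  velocity and of the test functions of the momentum equation.  Exterior traces of other functions
  do not occur in the scheme: {{theta}} = theta_B has been inserted in the boundary
  integral of the energy balance.
\<close>

definition trace_out :: "real ^ 'd \<Rightarrow> (real ^ 'd \<Rightarrow> 'b::real_normed_vector) \<Rightarrow> real ^ 'd \<Rightarrow> 'b" where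
  "trace_out n v x =
     (if n $ z * x $ z = H then - trace_in n v x
      else Lim (at_right 0) (\<lambda>\<delta>. v (x + \<delta> *\<^sub>R n)))"

definition jump :: "real ^ 'd \<Rightarrow> (real ^ 'd \<Rightarrow> 'b::real_normed_vector) \<Rightarrow> real ^ 'd \<Rightarrow> 'b" where
  "jump n v x = trace_out n v x - trace_in n v x"

definition avg :: "real ^ 'd \<Rightarrow> (real ^ 'd \<Rightarrow> 'b::real_normed_vector) \<Rightarrow> real ^ 'd \<Rightarrow> 'b" where
  "avg n v x = (1 / 2) *\<^sub>R (trace_in n v x + trace_out n v x)"

definition normals :: "(real ^ 'd) set" where
  "normals = (\<Union>j. {axis j 1, - axis j 1})"

text \<open>Averages are constant on faces; they are evaluated at the midpoint of the face.\<close>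

definition face_midpoint :: "real ^ 'd \<Rightarrow> real ^ 'd \<Rightarrow> real ^ 'd" where
  "face_midpoint c n = c + (h / 2) *\<^sub>R ((\<chi> i. 1) + n)"

definition grad_h :: "(real ^ 'd \<Rightarrow> real) \<Rightarrow> real ^ 'd \<Rightarrow> real ^ 'd" where
  "grad_h v x = (1 / h) *\<^sub>R (\<Sum>c\<in>cell_corners. indicat_real (cell c) x *\<^sub>R
     (\<Sum>n\<in>normals. avg n v (face_midpoint c n) *\<^sub>R n))"

definition Grad_h :: "(real ^ 'd \<Rightarrow> real ^ 'd) \<Rightarrow> real ^ 'd \<Rightarrow> real ^ 'd ^ 'd" where
  "Grad_h v x = (\<chi> i. grad_h (\<lambda>y. v y $ i) x)"

definition div_h :: "(real ^ 'd \<Rightarrow> real ^ 'd) \<Rightarrow> real ^ 'd \<Rightarrow> real" where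
  "div_h v x = (1 / h) * (\<Sum>c\<in>cell_corners. indicat_real (cell c) x *
     (\<Sum>n\<in>normals. n \<bullet> avg n v (face_midpoint c n)))"

definition D_h :: "(real ^ 'd \<Rightarrow> real ^ 'd) \<Rightarrow> real ^ 'd \<Rightarrow> real ^ 'd ^ 'd" where
  "D_h v x = (1 / 2) *\<^sub>R (Grad_h v x + transpose (Grad_h v x))"

definition upwind ::
    "(real ^ 'd \<Rightarrow> real ^ 'd) \<Rightarrow> real ^ 'd \<Rightarrow> (real ^ 'd \<Rightarrow> 'b::real_normed_vector) \<Rightarrow> real ^ 'd \<Rightarrow> 'b" where
  "upwind u n r x = (if avg n u x \<bullet> n \<ge> 0 then trace_in n r x else trace_out n r x)"

definition flux ::
    "real \<Rightarrow> (real ^ 'd \<Rightarrow> 'b::real_normed_vector) \<Rightarrow> (real ^ 'd \<Rightarrow> real ^ 'd) \<Rightarrow> real ^ 'd \<Rightarrow> real ^ 'd \<Rightarrow> 'b" where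
  "flux \<alpha> r u n x = (avg n u x \<bullet> n) *\<^sub>R upwind u n r x - (h powr \<alpha>) *\<^sub>R jump n r x"

text \<open>
  The full tensor S - p I.  The inner product of two matrices, used with it in the scheme, is the
  Frobenius product A : B.
\<close>

definition stress ::
    "real \<Rightarrow> real \<Rightarrow> (real ^ 'd \<Rightarrow> real) \<Rightarrow> (real ^ 'd \<Rightarrow> real ^ 'd) \<Rightarrow> (real ^ 'd \<Rightarrow> real) \<Rightarrow>
     real ^ 'd \<Rightarrow> real ^ 'd ^ 'd" where
  "stress \<mu> \<eta> \<rho> u \<theta> x =
     (2 * \<mu>) *\<^sub>R D_h u x + ((\<eta> - 2 / real CARD('d) * \<mu>) * div_h u x) *\<^sub>R mat 1
       - (\<rho> x * \<theta> x) *\<^sub>R mat 1"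

end


subsection \<open>The scheme\<close>

context
  fixes L H h :: real and z :: "'d::finite" and dt \<alpha> \<mu> \<eta> \<kappa> \<gamma> :: real
    and G \<theta>B :: "real ^ 'd \<Rightarrow> real"
begin

text \<open>In the next three definitions the index 0 marks the values at the previous time level.\<close>

definition continuity_eq ::
    "(real ^ 'd \<Rightarrow> real) \<Rightarrow> (real ^ 'd \<Rightarrow> real) \<Rightarrow> (real ^ 'd \<Rightarrow> real ^ 'd) \<Rightarrow> bool" where
  "continuity_eq \<rho>0 \<rho> u \<longleftrightarrow> (\<forall>\<phi>\<in>Qh L H h z.
     (LINT x:Omega L H z|lborel. (\<rho> x - \<rho>0 x) / dt * \<phi> x)
     - int_face_integral L H h z (\<lambda>n x. flux H h z \<alpha> \<rho> u n x * jump H z n \<phi> x) = 0)"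

definition momentum_eq ::
    "(real ^ 'd \<Rightarrow> real) \<Rightarrow> (real ^ 'd \<Rightarrow> real ^ 'd) \<Rightarrow>
     (real ^ 'd \<Rightarrow> real) \<Rightarrow> (real ^ 'd \<Rightarrow> real ^ 'd) \<Rightarrow> (real ^ 'd \<Rightarrow> real) \<Rightarrow> bool" where
  "momentum_eq \<rho>0 u0 \<rho> u \<theta> \<longleftrightarrow> (\<forall>\<phi>\<in>Qh L H h z.
     (LINT x:Omega L H z|lborel. ((1 / dt) *\<^sub>R (\<rho> x *\<^sub>R u x - \<rho>0 x *\<^sub>R u0 x)) \<bullet> \<phi> x)
     - int_face_integral L H h z
         (\<lambda>n x. flux H h z \<alpha> (\<lambda>y. \<rho> y *\<^sub>R u y) u n x \<bullet> jump H z n \<phi> x)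
     + (LINT x:Omega L H z|lborel. stress L H h z \<mu> \<eta> \<rho> u \<theta> x \<bullet> D_h L H h z \<phi> x)
     = (LINT x:Omega L H z|lborel. (\<rho> x *\<^sub>R gradient H z G x) \<bullet> \<phi> x))"

definition energy_eq ::
    "(real ^ 'd \<Rightarrow> real) \<Rightarrow> (real ^ 'd \<Rightarrow> real) \<Rightarrow>
     (real ^ 'd \<Rightarrow> real) \<Rightarrow> (real ^ 'd \<Rightarrow> real ^ 'd) \<Rightarrow> (real ^ 'd \<Rightarrow> real) \<Rightarrow> bool" where
  "energy_eq \<rho>0 \<theta>0 \<rho> u \<theta> \<longleftrightarrow> (let cv = 1 / (\<gamma> - 1) in \<forall>\<phi>\<in>Qh L H h z.
     cv * (LINT x:Omega L H z|lborel. (\<rho> x * \<theta> x - \<rho>0 x * \<theta>0 x) / dt * \<phi> x)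
     - cv * int_face_integral L H h z
         (\<lambda>n x. flux H h z \<alpha> (\<lambda>y. \<rho> y * \<theta> y) u n x * jump H z n \<phi> x)
     + int_face_integral L H h z (\<lambda>n x. \<kappa> / h * jump H z n \<theta> x * jump H z n \<phi> x)
     + 2 * ext_face_integral L H h z
         (\<lambda>n x. \<kappa> / h * (trace_in n \<theta> x - \<theta>B x) * trace_in n \<phi> x)
     = (LINT x:Omega L H z|lborel. (stress L H h z \<mu> \<eta> \<rho> u \<theta> x \<bullet> Grad_h L H h z u x) * \<phi> x))"

text \<open>
  An element of Q_h^(d+2) is a function in Qh with values (density, velocity, temperature).
\<close>

definition scheme_step ::
    "(real ^ 'd \<Rightarrow> real \<times> (real ^ 'd) \<times> real) \<Rightarrow> (real ^ 'd \<Rightarrow> real \<times> (real ^ 'd) \<times> real) \<Rightarrow> bool" where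
  "scheme_step U0 U \<longleftrightarrow>
     (let \<rho>0 = (\<lambda>x. fst (U0 x)); u0 = (\<lambda>x. fst (snd (U0 x))); \<theta>0 = (\<lambda>x. snd (snd (U0 x)));
          \<rho> = (\<lambda>x. fst (U x)); u = (\<lambda>x. fst (snd (U x))); \<theta> = (\<lambda>x. snd (snd (U x)))
      in continuity_eq \<rho>0 \<rho> u \<and> momentum_eq \<rho>0 u0 \<rho> u \<theta> \<and> energy_eq \<rho>0 \<theta>0 \<rho> u \<theta>)"

definition discrete_solution ::
    "real \<Rightarrow> (real \<Rightarrow> real ^ 'd \<Rightarrow> real \<times> (real ^ 'd) \<times> real) \<Rightarrow> bool" where
  "discrete_solution T U \<longleftrightarrow> (\<forall>k::nat.
     U (T + real k * dt) \<in> Qh L H h z \<and>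
     scheme_step (U (T + real k * dt)) (U (T + real (Suc k) * dt)) \<and>
     (\<forall>s\<in>{0..1}. \<forall>x. U (T + (real k + s) * dt) x =
        (1 - s) *\<^sub>R U (T + real k * dt) x + s *\<^sub>R U (T + real (Suc k) * dt) x))"

text \<open>Continuity in time is with respect to the supremum norm on Q_h^(d+2).\<close>

definition entire_discrete_solution ::
    "(real \<Rightarrow> real ^ 'd \<Rightarrow> real \<times> (real ^ 'd) \<times> real) \<Rightarrow> bool" where
  "entire_discrete_solution U \<longleftrightarrow>
     (\<forall>t. U t \<in> Qh L H h z) \<and>
     (\<forall>t. uniform_limit (Omega L H z) U (U t) (at t)) \<and>
     (\<exists>\<tau>. \<forall>n::nat. discrete_solution (\<tau> - real n * dt) U)"

end

end

theory Submission
  imports Defs "HOL-Complex_Analysis.Great_Picard"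
begin

text \<open>
  With \<open>h\<close> and \<open>dt\<close> fixed the statement is a compactness argument in a finite-dimensional space.
  A function in \<^const>\<open>Qh\<close> is determined by its finitely many values at the corners of the
  cells, and a discrete solution is determined by its values at the time nodes.  The uniform bounds
  and a diagonal argument over the countable set of pairs (node, corner) give a subsequence
  along which all nodal values converge (\<open>entire_solution_subsequence\<close>).

  The time grids of the solutions differ: \<open>T n\<close> is congruent modulo \<open>dt\<close> to an offset
  \<open>\<tau> n\<close> in \<open>[0, dt)\<close> that varies with \<open>n\<close>.  The offsets take part in the extraction, the limit solution
  has its nodes at \<open>\<tau>' + k * dt\<close> for \<open>\<tau>'\<close> the limit of the offsets, and shifting the time grid
  costs little because an interpolant of values bounded by \<open>B\<close> is Lipschitz in time with constant
  \<open>2 * B / dt\<close> (\<open>interpolate_Lipschitz\<close>).  Since any compact time interval meets finitely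
  many nodes, convergence at each of them gives uniform convergence.

  That the limit values satisfy the scheme (\<open>scheme_step_limit\<close>) follows from their pointwise
  convergence.  A ray issuing from a point stays in a single cell for a short while, so the trace of a
  piecewise constant function is its value at some point that depends on the ray alone
  (\<open>Lim_ray_eq_point_value\<close>).  Hence traces, jumps, averages and the difference operators are
  continuous under pointwise convergence, and so is the upwind flux: the switch of the upwind value
  happens where its factor, the normal velocity, vanishes.  Every integral in the scheme is a
  finite sum of point values of its integrand times a weight that does not depend on the solution;
  for the gravity term the weights are integrals of the potential gradient over the cells.
\<close>

section \<open>Piecewise linear interpolation in time\<close>

text \<open>
  Time is measured in units of the step, so that the nodes are the integers.
\<close>

definition interpolate :: "(int \<Rightarrow> 'a::real_vector) \<Rightarrow> real \<Rightarrow> 'a" where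
  "interpolate w s = (1 - frac s) *\<^sub>R w \<lfloor>s\<rfloor> + frac s *\<^sub>R w (\<lfloor>s\<rfloor> + 1)"

lemma interpolate_of_int [simp]: "interpolate w (of_int k) = w k"
  by (simp add: interpolate_def)

text \<open>
  The right endpoint \<open>s = 1\<close> is included, as it is in the definition of discrete solutions; there
  the interpolant has already passed to the next segment.
\<close>

lemma interpolate_segment:
  assumes "0 \<le> s" "s \<le> 1"
  shows "interpolate w (of_int k + s) = (1 - s) *\<^sub>R w k + s *\<^sub>R w (k + 1)"
proof (cases "s = 1")
  case True
  then show ?thesis
    using interpolate_of_int[of w "k + 1"] by simp
next
  case False
  then have "\<lfloor>of_int k + s\<rfloor> = k"
    using assms by (simp add: floor_eq_iff)
  then show ?thesis by (simp add: interpolate_def frac_def)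
qed

lemma interpolate_diff_bound:
  fixes v w :: "int \<Rightarrow> 'a::real_normed_vector"
  assumes "norm (v \<lfloor>s\<rfloor> - w \<lfloor>s\<rfloor>) \<le> e" "norm (v (\<lfloor>s\<rfloor> + 1) - w (\<lfloor>s\<rfloor> + 1)) \<le> e"
  shows "norm (interpolate v s - interpolate w s) \<le> e"
proof -
  have f: "0 \<le> frac s" "frac s \<le> 1" by (simp_all add: frac_lt_1 less_imp_le)
  have "interpolate v s - interpolate w s
      = (1 - frac s) *\<^sub>R (v \<lfloor>s\<rfloor> - w \<lfloor>s\<rfloor>) + frac s *\<^sub>R (v (\<lfloor>s\<rfloor> + 1) - w (\<lfloor>s\<rfloor> + 1))"
    by (simp add: interpolate_def algebra_simps)
  also have "norm \<dots> \<le> (1 - frac s) * norm (v \<lfloor>s\<rfloor> - w \<lfloor>s\<rfloor>) + frac s * norm (v (\<lfloor>s\<rfloor> + 1) - w (\<lfloor>s\<rfloor> + 1))"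
    using f by (intro norm_triangle_le) simp
  also have "\<dots> \<le> (1 - frac s) * e + frac s * e"
    using f assms by (intro add_mono mult_left_mono) auto
  finally show ?thesis by (simp add: algebra_simps)
qed

text \<open>
  On one segment the slope is a difference of two nodal values, hence at most \<open>2 * B\<close>.  Between points of
  different segments the path goes through the first node after \<open>s\<close> and the last node before \<open>t\<close>; these
  nodes either coincide or are at least one unit of time apart, so that the difference of their
  values is again at most \<open>2 * B\<close> times their distance.
\<close>

lemma interpolate_Lipschitz:
  fixes w :: "int \<Rightarrow> 'a::real_normed_vector"
  assumes B: "\<And>k. norm (w k) \<le> B"
  shows "norm (interpolate w t - interpolate w s) \<le> 2 * B * \<bar>t - s\<bar>"
proof -
  have step: "norm (w k - w l) \<le> 2 * B" for k l
    using norm_triangle_ineq4[of "w k" "w l"] B[of k] B[of l] by linarith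
  have B0: "B \<ge> 0" using B[of 0] norm_ge_zero order_trans by blast
  have *: "norm (interpolate w t - interpolate w s) \<le> 2 * B * (t - s)" if "s \<le> t" for s t
  proof (cases "\<lfloor>s\<rfloor> = \<lfloor>t\<rfloor>")
    case True
    then have "frac t - frac s = t - s" by (simp add: frac_def)
    moreover have "interpolate w t - interpolate w s = (frac t - frac s) *\<^sub>R (w (\<lfloor>s\<rfloor> + 1) - w \<lfloor>s\<rfloor>)"
      by (simp add: interpolate_def True algebra_simps)
    ultimately have "norm (interpolate w t - interpolate w s) = (t - s) * norm (w (\<lfloor>s\<rfloor> + 1) - w \<lfloor>s\<rfloor>)"
      using that by simp
    also have "\<dots> \<le> (t - s) * (2 * B)"
      using that step by (intro mult_left_mono) auto
    finally show ?thesis by (simp add: mult_ac)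
  next
    case False
    then have less: "\<lfloor>s\<rfloor> + 1 \<le> \<lfloor>t\<rfloor>" using that floor_mono[of s t] by linarith
    have "interpolate w t - w \<lfloor>t\<rfloor> = frac t *\<^sub>R (w (\<lfloor>t\<rfloor> + 1) - w \<lfloor>t\<rfloor>)"
      by (simp add: interpolate_def algebra_simps)
    then have 1: "norm (interpolate w t - w \<lfloor>t\<rfloor>) \<le> frac t * (2 * B)"
      using step by (simp add: mult_left_mono)
    have "w (\<lfloor>s\<rfloor> + 1) - interpolate w s = (1 - frac s) *\<^sub>R (w (\<lfloor>s\<rfloor> + 1) - w \<lfloor>s\<rfloor>)"
      by (simp add: interpolate_def algebra_simps)
    then have 2: "norm (w (\<lfloor>s\<rfloor> + 1) - interpolate w s) \<le> (1 - frac s) * (2 * B)"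
      using step frac_lt_1[of s] by (simp add: mult_left_mono)
    have 3: "norm (w \<lfloor>t\<rfloor> - w (\<lfloor>s\<rfloor> + 1)) \<le> of_int (\<lfloor>t\<rfloor> - (\<lfloor>s\<rfloor> + 1)) * (2 * B)"
    proof (cases "\<lfloor>t\<rfloor> = \<lfloor>s\<rfloor> + 1")
      case False
      then have "1 \<le> \<lfloor>t\<rfloor> - (\<lfloor>s\<rfloor> + 1)" using less by linarith
      then have "1 \<le> real_of_int (\<lfloor>t\<rfloor> - (\<lfloor>s\<rfloor> + 1))" by linarith
      then have "1 * (2 * B) \<le> of_int (\<lfloor>t\<rfloor> - (\<lfloor>s\<rfloor> + 1)) * (2 * B)"
        using B0 by (intro mult_right_mono) auto
      then show ?thesis using step[of "\<lfloor>t\<rfloor>" "\<lfloor>s\<rfloor> + 1"] by linarith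
    qed simp
    have "norm (interpolate w t - interpolate w s)
        \<le> norm (interpolate w t - w \<lfloor>t\<rfloor>) + norm (w \<lfloor>t\<rfloor> - w (\<lfloor>s\<rfloor> + 1)) + norm (w (\<lfloor>s\<rfloor> + 1) - interpolate w s)"
      using norm_triangle_ineq[of "interpolate w t - w \<lfloor>t\<rfloor>" "w \<lfloor>t\<rfloor> - interpolate w s"]
        norm_triangle_ineq[of "w \<lfloor>t\<rfloor> - w (\<lfloor>s\<rfloor> + 1)" "w (\<lfloor>s\<rfloor> + 1) - interpolate w s"] by simp
    also have "\<dots> \<le> frac t * (2 * B) + of_int (\<lfloor>t\<rfloor> - (\<lfloor>s\<rfloor> + 1)) * (2 * B) + (1 - frac s) * (2 * B)"
      using 1 2 3 by linarith
    also have "\<dots> = 2 * B * (t - s)"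
      by (simp add: frac_def algebra_simps)
    finally show ?thesis .
  qed
  show ?thesis
  proof (cases "s \<le> t")
    case True
    then show ?thesis using *[OF True] by simp
  next
    case False
    then show ?thesis using *[of t s] by (simp add: norm_minus_commute)
  qed
qed

lemma interpolate_shift: "interpolate (\<lambda>k. w (k + m)) s = interpolate w (s + of_int m)"
  by (simp add: interpolate_def frac_def add_ac)

text \<open>
  The integer index \<open>K\<close> of the first node allows all the solutions started at nodes of
  one grid to be restrictions of the same interpolant.
\<close>

lemma discrete_solution_interpolate:
  fixes W :: "int \<Rightarrow> real ^ 'd::finite \<Rightarrow> real \<times> (real ^ 'd) \<times> real"
  assumes dt: "dt > 0"
    and Qh: "\<And>k. k \<ge> K \<Longrightarrow> W k \<in> Qh L H h z"
    and step: "\<And>k. k \<ge> K \<Longrightarrow> scheme_step L H h z dt \<alpha> \<mu> \<eta> \<kappa> \<gamma> G \<theta>B (W k) (W (k + 1))"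
  shows "discrete_solution L H h z dt \<alpha> \<mu> \<eta> \<kappa> \<gamma> G \<theta>B (\<tau> + of_int K * dt)
           (\<lambda>t x. interpolate (\<lambda>k. W k x) ((t - \<tau>) / dt))"
proof -
  have seg: "(\<tau> + of_int K * dt + (real k + s) * dt - \<tau>) / dt = of_int (K + int k) + s" for k s
    using dt by (simp add: field_simps)
  have "(\<tau> + of_int K * dt + real k * dt - \<tau>) / dt = of_int (K + int k)" for k
    using seg[of k 0] by simp
  then have node: "(\<lambda>x. interpolate (\<lambda>k. W k x) ((\<tau> + of_int K * dt + real k * dt - \<tau>) / dt)) = W (K + int k)" for k
    by (simp only: interpolate_of_int)
  have node': "W (K + int (Suc k)) = W (K + int k + 1)" for k by (simp add: add_ac)
  show ?thesis
    unfolding discrete_solution_def node seg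
    unfolding node'
    using Qh step by (auto simp: interpolate_segment simp del: of_int_add)
qed

lemma discrete_solution_eq_interpolate:
  fixes U :: "real \<Rightarrow> real ^ 'd::finite \<Rightarrow> real \<times> (real ^ 'd) \<times> real"
  assumes sol: "discrete_solution L H h z dt \<alpha> \<mu> \<eta> \<kappa> \<gamma> G \<theta>B T U" and dt: "dt > 0" and t: "t \<ge> T"
  shows "U t x = interpolate (\<lambda>k. U (T + of_int k * dt) x) ((t - T) / dt)"
proof -
  define s where "s = (t - T) / dt"
  define k where "k = nat \<lfloor>s\<rfloor>"
  have "s \<ge> 0" using t dt by (simp add: s_def)
  then have k: "\<lfloor>s\<rfloor> = int k" by (simp add: k_def)
  have f: "frac s \<in> {0..1}" using frac_lt_1[of s] by simp
  have "T + (real k + frac s) * dt = t"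
    using k dt by (simp add: frac_def s_def)
  moreover have "U (T + (real k + frac s) * dt) x
      = (1 - frac s) *\<^sub>R U (T + real k * dt) x + frac s *\<^sub>R U (T + real (Suc k) * dt) x"
    using sol f unfolding discrete_solution_def by blast
  ultimately show ?thesis
    by (simp add: interpolate_def s_def[symmetric] k add_ac)
qed

section \<open>Cells of the mesh and functions constant on them\<close>

locale channel_mesh =
  fixes L H h :: real and z :: "'d::finite"
  assumes L_pos: "L > 0" and H_pos: "H > 0" and h_pos: "h > 0"
    and mesh: "admissible_mesh L H h"
begin

text \<open>
  The index is defined on the whole space, beyond the domain: shifts by a period and small
  displacements across a face then become statements about integers.  A function is constant on the mesh iff it
  factors through the index; this property, unlike membership in \<^const>\<open>Qh\<close>, is preserved by all
  pointwise operations and by the difference operators.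
\<close>

definition cell_index :: "real ^ 'd \<Rightarrow> 'd \<Rightarrow> int" where
  "cell_index x i = \<lfloor>(x $ i - lo L H z $ i) / h\<rfloor>"

definition mesh_constant :: "(real ^ 'd \<Rightarrow> 'b) \<Rightarrow> bool" where
  "mesh_constant f \<longleftrightarrow> (\<forall>x y. cell_index x = cell_index y \<longrightarrow> f x = f y)"

definition cell_count :: "'d \<Rightarrow> int" where
  "cell_count i = \<lfloor>(hi L H z $ i - lo L H z $ i) / h\<rfloor>"

lemma cell_count: "hi L H z $ i = lo L H z $ i + of_int (cell_count i) * h" "cell_count i > 0"
proof -
  obtain N M :: nat where N: "2 * L = real N * h" and M: "2 * H = real M * h"
    using mesh unfolding admissible_mesh_def by blast
  have "\<exists>n::nat. hi L H z $ i - lo L H z $ i = real n * h"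
  proof (cases "i = z")
    case True
    then show ?thesis using M by (intro exI[of _ M]) (simp add: hi_def lo_def)
  next
    case False
    then show ?thesis using N by (intro exI[of _ N]) (simp add: hi_def lo_def)
  qed
  then obtain n :: nat where n: "hi L H z $ i - lo L H z $ i = real n * h" by blast
  have c: "cell_count i = int n"
    using h_pos by (simp add: cell_count_def n)
  show "hi L H z $ i = lo L H z $ i + of_int (cell_count i) * h"
    using n by (simp add: c)
  have "hi L H z $ i - lo L H z $ i > 0"
    using L_pos H_pos by (simp add: hi_def lo_def)
  then show "cell_count i > 0"
    using n h_pos by (cases n) (auto simp: c)
qed

definition corner :: "('d \<Rightarrow> int) \<Rightarrow> real ^ 'd" where
  "corner k = (\<chi> i. lo L H z $ i + of_int (k i) * h)"

lemma cell_index_corner [simp]: "cell_index (corner k) = k"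
  using h_pos by (auto simp: cell_index_def corner_def)

lemma corner_cell_index: "c \<in> grid L H h z \<Longrightarrow> corner (cell_index c) = c"
proof -
  assume "c \<in> grid L H h z"
  then have "\<forall>i. \<exists>k::int. c $ i = lo L H z $ i + of_int k * h" by (simp add: grid_def)
  then obtain k :: "'d \<Rightarrow> int" where "\<forall>i. c $ i = lo L H z $ i + of_int (k i) * h" by metis
  then have "c = corner k" by (simp add: corner_def vec_eq_iff)
  then show ?thesis by simp
qed

lemma corner_in_grid: "corner k \<in> grid L H h z"
  by (auto simp: grid_def corner_def)

lemma mem_cell_corner_iff: "x \<in> cell h (corner k) \<longleftrightarrow> cell_index x = k"
proof -
  have "(corner k $ i \<le> x $ i \<and> x $ i < corner k $ i + h) \<longleftrightarrow> cell_index x i = k i" for i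
    using h_pos by (simp add: cell_index_def corner_def floor_eq_iff field_simps)
  then show ?thesis by (auto simp: cell_def)
qed

lemma corner_in_cell_corners_iff:
  "corner k \<in> cell_corners L H h z \<longleftrightarrow> (\<forall>i. 0 \<le> k i \<and> k i < cell_count i)"
proof -
  have "lo L H z $ i \<le> corner k $ i \<longleftrightarrow> 0 \<le> k i" for i
    using h_pos by (simp add: corner_def zero_le_mult_iff)
  moreover have "corner k $ i < hi L H z $ i \<longleftrightarrow> k i < cell_count i" for i
    using h_pos by (simp add: corner_def cell_count)
  ultimately show ?thesis
    using corner_in_grid by (simp add: cell_corners_def)
qed

lemma cell_corners_eq: "cell_corners L H h z = corner ` (\<Pi> i\<in>UNIV. {0..<cell_count i})"
proof -
  have "c \<in> range corner" if "c \<in> cell_corners L H h z" for c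
    using that corner_cell_index[of c, symmetric] by (auto simp: cell_corners_def)
  then show ?thesis
    using corner_in_cell_corners_iff by (force simp: Pi_iff)
qed

lemma cell_corner_eq: "c \<in> cell_corners L H h z \<Longrightarrow> corner (cell_index c) = c"
  by (simp add: cell_corners_def corner_cell_index)

lemma finite_cell_corners: "finite (cell_corners L H h z)"
proof -
  have "(\<Pi> i\<in>UNIV. {0..<cell_count i}) = PiE UNIV (\<lambda>i. {0..<cell_count i})"
    by (simp add: PiE_UNIV_domain)
  then show ?thesis
    by (simp add: cell_corners_eq finite_PiE)
qed

text \<open>
  For \<open>x\<close> in the channel this is the corner of the cell of the domain that contains a periodic
  translate of \<open>x\<close>.
\<close>

definition home_corner :: "real ^ 'd \<Rightarrow> real ^ 'd" where
  "home_corner x = corner (\<lambda>i. if i = z then cell_index x i else cell_index x i mod cell_count i)"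

definition in_channel :: "real ^ 'd \<Rightarrow> bool" where
  "in_channel x \<longleftrightarrow> 0 \<le> cell_index x z \<and> cell_index x z < cell_count z"

lemma in_channel_iff: "in_channel x \<longleftrightarrow> - H \<le> x $ z \<and> x $ z < H"
proof -
  have "H = - H + of_int (cell_count z) * h"
    using cell_count(1)[of z] by (simp add: hi_def lo_def)
  then have *: "(x $ z + H) / h < of_int (cell_count z) \<longleftrightarrow> x $ z < H"
    using h_pos by (simp add: divide_less_eq) linarith
  have "0 \<le> (x $ z + H) / h \<longleftrightarrow> - H \<le> x $ z"
    using h_pos by (simp add: zero_le_divide_iff) linarith
  with * show ?thesis
    by (simp add: in_channel_def cell_index_def lo_def floor_less_iff)
qed

lemma home_corner_in_cell_corners: "in_channel x \<Longrightarrow> home_corner x \<in> cell_corners L H h z"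
  using cell_count(2) by (auto simp: home_corner_def corner_in_cell_corners_iff in_channel_def)

lemma periodic_int:
  assumes "periodic L z f" "j \<noteq> z"
  shows "f (x + (of_int q * (2 * L)) *\<^sub>R axis j 1) = f x"
proof (induction q rule: int_induct[where k = 0])
  case (step1 i)
  have "x + (of_int (i + 1) * (2 * L)) *\<^sub>R axis j 1
      = (x + (of_int i * (2 * L)) *\<^sub>R axis j 1) + (2 * L) *\<^sub>R axis j 1"
    by (simp add: algebra_simps)
  then show ?case using step1 assms by (metis periodic_def)
next
  case (step2 i)
  have "x + (of_int i * (2 * L)) *\<^sub>R axis j 1
      = (x + (of_int (i - 1) * (2 * L)) *\<^sub>R axis j 1) + (2 * L) *\<^sub>R axis j 1"
    by (simp add: algebra_simps)
  then show ?case using step2 assms by (metis periodic_def)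
qed simp

lemma periodic_lattice:
  fixes f :: "real ^ 'd \<Rightarrow> 'b" and q :: "'d \<Rightarrow> int"
  assumes "periodic L z f" and "finite J" "z \<notin> J"
  shows "f (x + (\<Sum>j\<in>J. (of_int (q j) * (2 * L)) *\<^sub>R axis j 1)) = f x"
  using assms(2,3)
proof (induction J)
  case (insert j J)
  have "f (x + (\<Sum>j\<in>insert j J. (of_int (q j) * (2 * L)) *\<^sub>R axis j 1))
     = f ((x + (\<Sum>j\<in>J. (of_int (q j) * (2 * L)) *\<^sub>R axis j 1)) + (of_int (q j) * (2 * L)) *\<^sub>R axis j 1)"
    using insert.hyps by (simp add: algebra_simps)
  also have "\<dots> = f (x + (\<Sum>j\<in>J. (of_int (q j) * (2 * L)) *\<^sub>R axis j 1))"
    using insert.prems by (intro periodic_int[OF assms(1)]) auto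
  also have "\<dots> = f x"
    using insert by simp
  finally show ?case .
qed simp

text \<open>
  The point \<open>x\<close> is translated by multiples of \<open>2 * L\<close> in the periodic directions; since the period is
  a whole number of cells, this reduces the index modulo the number of cells.
\<close>

lemma Qh_eq_home_corner:
  assumes v: "v \<in> Qh L H h z" and "in_channel x"
  shows "v x = v (home_corner x)"
proof -
  define q where "q i = - (cell_index x i div cell_count i)" for i
  define y where "y = x + (\<Sum>j\<in>- {z}. (of_int (q j) * (2 * L)) *\<^sub>R axis j 1)"
  have y: "y $ i = (if i = z then x $ i else x $ i + of_int (q i * cell_count i) * h)" for i
  proof (cases "i = z")
    case True
    then show ?thesis
      by (auto simp: y_def axis_def if_distrib intro!: sum.neutral cong: if_cong)
  next
    case False
    have "y $ i = x $ i + (\<Sum>j\<in>- {z}. if j = i then of_int (q i) * (2 * L) else 0)"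
      unfolding y_def by (auto simp: axis_def if_distrib intro!: sum.cong cong: if_cong)
    also have "\<dots> = x $ i + of_int (q i) * (2 * L)"
      using False by simp
    also have "2 * L = of_int (cell_count i) * h"
      using cell_count(1)[of i] False by (simp add: hi_def lo_def)
    finally show ?thesis using False by simp
  qed
  have "cell_index y = (\<lambda>i. if i = z then cell_index x i else cell_index x i mod cell_count i)"
  proof
    fix i
    have "cell_index y i = cell_index x i + q i * cell_count i" if "i \<noteq> z"
    proof -
      have "(y $ i - lo L H z $ i) / h = (x $ i - lo L H z $ i) / h + of_int (q i * cell_count i)"
        using that h_pos by (simp add: y field_simps)
      then show ?thesis unfolding cell_index_def by linarith
    qed
    then show "cell_index y i = (if i = z then cell_index x i else cell_index x i mod cell_count i)"
      by (auto simp: q_def y cell_index_def minus_div_mult_eq_mod[symmetric])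
  qed
  then have "y \<in> cell h (home_corner x)" "home_corner x \<in> cell h (home_corner x)"
    by (simp_all add: home_corner_def mem_cell_corner_iff)
  moreover have "v constant_on cell h (home_corner x)"
    using v home_corner_in_cell_corners[OF assms(2)] by (auto simp: Qh_def)
  ultimately have "v y = v (home_corner x)"
    by (auto simp: constant_on_def)
  moreover have "v y = v x"
    unfolding y_def using v by (intro periodic_lattice) (auto simp: Qh_def)
  ultimately show ?thesis by simp
qed

lemma Qh_eq_0: "v \<in> Qh L H h z \<Longrightarrow> \<not> in_channel x \<Longrightarrow> v x = 0"
  by (auto simp: Qh_def in_channel_iff)

lemma Qh_mesh_constant: 
  fixes v :: "real ^ 'd \<Rightarrow> 'b::zero"
  assumes v: "v \<in> Qh L H h z" shows "mesh_constant v"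
  unfolding mesh_constant_def
proof (intro allI impI)
  fix x y :: "real ^ 'd" assume eq: "cell_index x = cell_index y"
  then have "in_channel x = in_channel y" "home_corner x = home_corner y"
    by (simp_all add: in_channel_def home_corner_def cong: if_cong)
  then show "v x = v y"
    using Qh_eq_home_corner[OF v] Qh_eq_0[OF v] by metis
qed

text \<open>
  All conditions that define \<^const>\<open>Qh\<close> are equations between point values.
\<close>

lemma Qh_limit:
  fixes v :: "real ^ 'd \<Rightarrow> 'b::real_normed_vector"
  assumes V: "\<And>m::nat. V m \<in> Qh L H h z" and lim: "\<And>x. (\<lambda>m. V m x) \<longlonglongrightarrow> v x"
  shows "v \<in> Qh L H h z"
proof -
  have eq: "v x = v y" if "\<And>m. V m x = V m y" for x y
    using LIMSEQ_unique lim[of x] lim[of y] that by simp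
  have "v constant_on cell h c" if c: "c \<in> cell_corners L H h z" for c
    unfolding constant_on_def
  proof (intro exI[of _ "v c"] ballI)
    fix x assume "x \<in> cell h c"
    moreover have "c \<in> cell h c" using h_pos by (simp add: cell_def)
    ultimately show "v x = v c"
      using V c by (intro eq) (simp add: Qh_def constant_on_def, metis)
  qed
  moreover have "periodic L z v"
    unfolding periodic_def using V by (auto intro!: eq simp: Qh_def periodic_def)
  moreover have "v x = 0" if "x $ z < - H \<or> H \<le> x $ z" for x
  proof -
    have "V m x = 0" for m using V[of m] that by (auto simp: Qh_def)
    then show ?thesis using LIMSEQ_unique[OF lim[of x], of 0] by simp
  qed
  ultimately show ?thesis by (auto simp: Qh_def)
qed

lemma Qh_lincomb:
  fixes u v :: "real ^ 'd \<Rightarrow> 'b::real_vector"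
  assumes "u \<in> Qh L H h z" "v \<in> Qh L H h z"
  shows "(\<lambda>x. a *\<^sub>R u x + b *\<^sub>R v x) \<in> Qh L H h z"
proof -
  have "(\<lambda>x. a *\<^sub>R u x + b *\<^sub>R v x) constant_on S" if "u constant_on S" "v constant_on S" for S
    using that unfolding constant_on_def by metis
  then show ?thesis
    using assms by (auto simp: Qh_def periodic_def)
qed

lemma Qh_zero: "(\<lambda>_. 0) \<in> Qh L H h z"
  by (auto simp: Qh_def periodic_def constant_on_def)

section \<open>Integrals over cells\<close>

lemma cell_measurable [measurable]: "cell h c \<in> sets borel"
proof -
  have "cell h c = (\<Inter>i. {x. c $ i \<le> x $ i} \<inter> {x. x $ i < c $ i + h})"
    by (auto simp: cell_def)
  also have "\<dots> \<in> sets borel"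
    by (intro sets.finite_INT) (auto intro!: borel_closed borel_open closed_Collect_le open_Collect_less continuous_intros)
  finally show ?thesis .
qed

lemma cell_emeasure: "emeasure lborel (cell h c) > 0" "emeasure lborel (cell h c) < \<infinity>"
proof -
  let ?d = "(\<chi> i. c $ i + h)"
  have "cell h c \<subseteq> cbox c ?d" by (auto simp: cell_def mem_box_cart less_imp_le)
  then have "emeasure lborel (cell h c) \<le> emeasure lborel (cbox c ?d)"
    by (intro emeasure_mono) auto
  also have "\<dots> < \<infinity>" using emeasure_lborel_cbox_finite by (simp add: less_top[symmetric])
  finally show "emeasure lborel (cell h c) < \<infinity>" .
  have "box c ?d \<subseteq> cell h c" by (auto simp: cell_def mem_box_cart less_imp_le)
  then have "emeasure lborel (box c ?d) \<le> emeasure lborel (cell h c)"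
    by (intro emeasure_mono) auto
  moreover have "emeasure lborel (box c ?d) > 0"
  proof -
    have "c \<bullet> b \<le> ?d \<bullet> b \<and> (?d - c) \<bullet> b > 0" if "b \<in> Basis" for b
      using that h_pos by (auto simp: Basis_vec_def inner_axis)
    then show ?thesis by (auto simp: emeasure_lborel_box_eq intro!: prod_pos)
  qed
  ultimately show "emeasure lborel (cell h c) > 0" by simp
qed

text \<open>
  The index takes countably many values, each on a Borel set.
\<close>

lemma mesh_constant_measurable:
  fixes f :: "real ^ 'd \<Rightarrow> 'b::topological_space"
  assumes "mesh_constant f" shows "f \<in> borel_measurable borel"
proof -
  have "cell_index \<in> borel \<rightarrow>\<^sub>M count_space UNIV"
    unfolding measurable_count_space_eq2_countable
  proof (intro conjI ballI)
    fix k
    have "cell_index -` {k} = cell h (corner k)"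
      using mem_cell_corner_iff by auto
    then show "cell_index -` {k} \<inter> space borel \<in> sets borel" by simp
  qed simp
  then have "(\<lambda>x. f (corner (cell_index x))) \<in> borel_measurable borel"
    by (rule measurable_compose_countable[where f = "\<lambda>k x. f (corner k)", rotated]) simp
  moreover have "f (corner (cell_index x)) = f x" for x
    using assms unfolding mesh_constant_def by (metis cell_index_corner)
  ultimately show ?thesis by simp
qed

lemma cell_subset_Omega: "c \<in> cell_corners L H h z \<Longrightarrow> cell h c \<subseteq> Omega L H z"
proof
  fix x assume c: "c \<in> cell_corners L H h z" and "x \<in> cell h c"
  then obtain k where k: "c = corner k" "\<forall>i. 0 \<le> k i \<and> k i < cell_count i"
    using cell_corner_eq[OF c] corner_in_cell_corners_iff c by metis
  have x: "c $ i \<le> x $ i" "x $ i < c $ i + h" for i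
    using \<open>x \<in> cell h c\<close> by (auto simp: cell_def)
  have "lo L H z $ i \<le> x $ i \<and> x $ i \<le> hi L H z $ i" for i
  proof -
    have "real_of_int (k i) \<ge> 0" "real_of_int (k i) + 1 \<le> of_int (cell_count i)" 
      using k(2)[rule_format, of i] by linarith+
    then have "of_int (k i) * h \<ge> 0" "(of_int (k i) + 1) * h \<le> of_int (cell_count i) * h" 
      using h_pos by (auto intro!: mult_right_mono mult_nonneg_nonneg)
    then have "lo L H z $ i \<le> c $ i" "c $ i + h \<le> hi L H z $ i"
      by (simp_all add: k corner_def cell_count algebra_simps)
    then show ?thesis using x[of i] by linarith
  qed
  then show "x \<in> Omega L H z" by (simp add: Omega_def mem_box_cart)
qed

lemma box_subset_cells: "box (lo L H z) (hi L H z) \<subseteq> (\<Union>c\<in>cell_corners L H h z. cell h c)"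
proof
  fix x assume "x \<in> box (lo L H z) (hi L H z)"
  then have x: "lo L H z $ i < x $ i" "x $ i < hi L H z $ i" for i
    by (auto simp: mem_box_cart)
  have "0 \<le> cell_index x i \<and> cell_index x i < cell_count i" for i
    using x[of i] h_pos by (simp add: cell_index_def floor_less_iff cell_count field_simps)
  then have "corner (cell_index x) \<in> cell_corners L H h z"
    by (simp add: corner_in_cell_corners_iff)
  moreover have "x \<in> cell h (corner (cell_index x))"
    by (simp add: mem_cell_corner_iff)
  ultimately show "x \<in> (\<Union>c\<in>cell_corners L H h z. cell h c)" by blast
qed

text \<open>
  The closed box and the union of the half-open cells differ by part of the boundary of the box, a null
  set.  Measurability on the whole box has to be assumed because \<^term>\<open>lborel\<close> is not complete.
\<close>

lemma integral_Omega_eq_sum: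
  fixes f :: "real ^ 'd \<Rightarrow> real"
  assumes meas: "set_borel_measurable lborel (Omega L H z) f"
    and int: "\<And>c. c \<in> cell_corners L H h z \<Longrightarrow> set_integrable lborel (cell h c) f"
  shows "(LINT x:Omega L H z|lborel. f x) = (\<Sum>c\<in>cell_corners L H h z. LINT x:cell h c|lborel. f x)"
proof -
  let ?C = "\<Union>c\<in>cell_corners L H h z. cell h c"
  have C: "?C \<in> sets lborel" 
    using finite_cell_corners by (intro sets.finite_UN) auto
  have sub: "?C \<subseteq> Omega L H z" using cell_subset_Omega by blast
  have "(LINT x:Omega L H z|lborel. f x) = (LINT x:?C|lborel. f x)"
  proof (rule set_integral_cong_set)
    show "set_borel_measurable lborel ?C f"
      by (rule set_borel_measurable_subset[OF meas C sub])
    have "AE x in lborel. x \<notin> cbox (lo L H z) (hi L H z) - box (lo L H z) (hi L H z)"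
      using negligible_frontier_interval[of "lo L H z" "hi L H z"]
      by (intro AE_not_in) (simp add: null_sets_def emeasure_Diff negligible_iff_null_sets null_sets_completion_iff)
    then show "AE x in lborel. x \<in> ?C \<longleftrightarrow> x \<in> Omega L H z"
    proof eventually_elim
      case (elim x)
      then show ?case using box_subset_cells sub by (auto simp: Omega_def)
    qed
  qed (rule meas)
  also have "\<dots> = (\<Sum>c\<in>cell_corners L H h z. LINT x:cell h c|lborel. f x)"
  proof (rule set_integral_finite_Union)
    show "disjoint_family_on (cell h) (cell_corners L H h z)"
      unfolding disjoint_family_on_def disjoint_iff
      using cell_corner_eq mem_cell_corner_iff by metis
  qed (use finite_cell_corners int in auto)
  finally show ?thesis .
qed

lemma mesh_constant_eq_on_cell:
  assumes "mesh_constant f" "c \<in> cell_corners L H h z" "x \<in> cell h c"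
  shows "f x = f c"
proof -
  have "cell_index x = cell_index c"
    using assms(3) mem_cell_corner_iff[of x "cell_index c"] cell_corner_eq[OF assms(2)] by simp
  then show ?thesis using assms(1) unfolding mesh_constant_def by blast
qed

lemma set_integral_cell_const:
  fixes f :: "real ^ 'd \<Rightarrow> real"
  assumes "\<And>x. x \<in> cell h c \<Longrightarrow> f x = a"
  shows "(LINT x:cell h c|lborel. f x) = measure lborel (cell h c) * a"
    and "set_integrable lborel (cell h c) f"
proof -
  have "(LINT x:cell h c|lborel. f x) = (LINT x:cell h c|lborel. a)"
    using assms by (intro set_lebesgue_integral_cong) auto
  also have "\<dots> = measure lborel (cell h c) * a"
    using cell_emeasure(2)[of c] by (subst set_integral_const) auto
  finally show "(LINT x:cell h c|lborel. f x) = measure lborel (cell h c) * a" .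
  have "set_integrable lborel (cell h c) (\<lambda>_. a)"
    using cell_emeasure(2)[of c] unfolding set_integrable_def
    by (intro integrable_scaleR_left) (simp add: integrable_real_indicator)
  then show "set_integrable lborel (cell h c) f"
    using assms by (subst set_integrable_cong[OF refl refl]) auto
qed

text \<open>
  Cells have positive measure, so an almost everywhere bound sees every value of a piecewise
  constant function.
\<close>

lemma Qh_AE_imp_corner:
  assumes v: "v \<in> Qh L H h z" and AE: "AE x\<in>Omega L H z in lborel. P (v x)"
    and c: "c \<in> cell_corners L H h z"
  shows "P (v c)"
proof (rule ccontr)
  assume "\<not> P (v c)"
  then have neg: "\<not> P (v x)" if "x \<in> cell h c" for x
    using mesh_constant_eq_on_cell[OF Qh_mesh_constant[OF v] c that] by simp
  have "AE x in lborel. x \<notin> cell h c"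
    using AE
  proof eventually_elim
    case (elim x)
    then show ?case using neg cell_subset_Omega[OF c] by blast
  qed
  then have "emeasure lborel (cell h c) = 0"
    by (subst (asm) AE_iff_measurable[OF _ refl]) auto
  then show False using cell_emeasure(1)[of c] by simp
qed

lemma Qh_bound:
  assumes v: "v \<in> Qh L H h z" and "B \<ge> 0"
    and "\<And>c. c \<in> cell_corners L H h z \<Longrightarrow> norm (v c) \<le> B"
  shows "norm (v x) \<le> B"
  using assms Qh_eq_home_corner[OF v, of x] Qh_eq_0[OF v, of x] home_corner_in_cell_corners[of x]
  by (cases "in_channel x") auto

section \<open>Pointwise convergence of mesh functions\<close>

definition mesh_converges :: "(nat \<Rightarrow> real ^ 'd \<Rightarrow> 'b::real_normed_vector) \<Rightarrow> (real ^ 'd \<Rightarrow> 'b) \<Rightarrow> bool" where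
  "mesh_converges V v \<longleftrightarrow>
     (\<forall>m. mesh_constant (V m)) \<and> mesh_constant v \<and> (\<forall>x. (\<lambda>m. V m x) \<longlonglongrightarrow> v x)"

lemma mesh_convergesD:
  assumes "mesh_converges V v"
  shows "mesh_constant (V m)" "mesh_constant v" "(\<lambda>m. V m x) \<longlonglongrightarrow> v x"
  using assms by (auto simp: mesh_converges_def)

lemma mesh_constant_const: "mesh_constant (\<lambda>_. a)"
  by (simp add: mesh_constant_def)

lemma mesh_constant_comp: "mesh_constant f \<Longrightarrow> mesh_constant (\<lambda>x. F (f x))"
  unfolding mesh_constant_def by metis

lemma mesh_constant_comp2:
  "mesh_constant f \<Longrightarrow> mesh_constant g \<Longrightarrow> mesh_constant (\<lambda>x. F (f x) (g x))"
  unfolding mesh_constant_def by metis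

lemma mesh_converges_const: "mesh_constant v \<Longrightarrow> mesh_converges (\<lambda>_. v) v"
  by (simp add: mesh_converges_def)

lemma mesh_converges_comp2:
  assumes f: "mesh_converges f f'" and g: "mesh_converges g g'"
    and F: "\<And>a b. isCont (\<lambda>p. F (fst p) (snd p)) (a, b)"
  shows "mesh_converges (\<lambda>m x. F (f m x) (g m x)) (\<lambda>x. F (f' x) (g' x))"
  unfolding mesh_converges_def
proof (intro conjI allI)
  fix m x
  show "mesh_constant (\<lambda>x. F (f m x) (g m x))" "mesh_constant (\<lambda>x. F (f' x) (g' x))"
    using f g by (auto intro: mesh_constant_comp2[where F = F] mesh_convergesD)
  have "(\<lambda>m. (f m x, g m x)) \<longlonglongrightarrow> (f' x, g' x)"
    by (intro tendsto_Pair mesh_convergesD f g)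
  then show "(\<lambda>m. F (f m x) (g m x)) \<longlonglongrightarrow> F (f' x) (g' x)"
    using isCont_tendsto_compose[OF F] by fastforce
qed

lemma mesh_converges_mult:
  fixes f :: "nat \<Rightarrow> real ^ 'd \<Rightarrow> real"
  assumes "mesh_converges f f'" "mesh_converges g g'"
  shows "mesh_converges (\<lambda>m x. f m x * g m x) (\<lambda>x. f' x * g' x)"
  by (rule mesh_converges_comp2[where F = "(*)", OF assms]) (intro continuous_intros)

lemma mesh_converges_scaleR:
  assumes "mesh_converges f f'" "mesh_converges g g'"
  shows "mesh_converges (\<lambda>m x. f m x *\<^sub>R g m x) (\<lambda>x. f' x *\<^sub>R g' x)"
  by (rule mesh_converges_comp2[where F = "scaleR", OF assms]) (intro continuous_intros)

lemma mesh_converges_inner: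
  fixes f :: "nat \<Rightarrow> real ^ 'd \<Rightarrow> 'b::real_inner"
  assumes "mesh_converges f f'" "mesh_converges g g'"
  shows "mesh_converges (\<lambda>m x. f m x \<bullet> g m x) (\<lambda>x. f' x \<bullet> g' x)"
  by (rule mesh_converges_comp2[where F = "inner", OF assms]) (intro continuous_intros)

lemma mesh_converges_diff:
  assumes "mesh_converges f f'" "mesh_converges g g'"
  shows "mesh_converges (\<lambda>m x. f m x - g m x) (\<lambda>x. f' x - g' x)"
  by (rule mesh_converges_comp2[where F = "(-)", OF assms]) (intro continuous_intros)

lemma mesh_converges_add:
  assumes "mesh_converges f f'" "mesh_converges g g'"
  shows "mesh_converges (\<lambda>m x. f m x + g m x) (\<lambda>x. f' x + g' x)"
  by (rule mesh_converges_comp2[where F = "(+)", OF assms]) (intro continuous_intros)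

lemma mesh_converges_linear:
  assumes "mesh_converges f f'" "bounded_linear F"
  shows "mesh_converges (\<lambda>m x. F (f m x)) (\<lambda>x. F (f' x))"
  using assms(1) bounded_linear.tendsto[OF assms(2)] mesh_constant_comp[where F = F]
  unfolding mesh_converges_def by blast

lemma mesh_converges_vec:
  fixes f :: "nat \<Rightarrow> real ^ 'd \<Rightarrow> 'i::finite \<Rightarrow> 'b::real_normed_vector"
  assumes "\<And>i. mesh_converges (\<lambda>m x. f m x i) (\<lambda>x. f' x i)"
  shows "mesh_converges (\<lambda>m x. \<chi> i. f m x i) (\<lambda>x. \<chi> i. f' x i)"
  unfolding mesh_converges_def
proof (intro conjI allI)
  fix m x
  show "mesh_constant (\<lambda>x. \<chi> i. f m x i)" "mesh_constant (\<lambda>x. \<chi> i. f' x i)"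
    using assms unfolding mesh_converges_def mesh_constant_def vec_eq_iff vec_lambda_beta by blast+
  show "(\<lambda>m. \<chi> i. f m x i) \<longlonglongrightarrow> (\<chi> i. f' x i)"
    using mesh_convergesD(3)[OF assms] by (intro vec_tendstoI) simp
qed

text \<open>
  The integral is a finite sum of values at corners weighted by the volumes of the cells.
\<close>

lemma tendsto_integral_Omega:
  fixes f :: "real ^ 'd \<Rightarrow> real"
  assumes "mesh_converges F f"
  shows "(\<lambda>m. LINT x:Omega L H z|lborel. F m x) \<longlonglongrightarrow> (LINT x:Omega L H z|lborel. f x)"
proof -
  have eq: "(LINT x:Omega L H z|lborel. g x) =
      (\<Sum>c\<in>cell_corners L H h z. measure lborel (cell h c) * g c)" if g: "mesh_constant g" for g
  proof -
    have "set_borel_measurable lborel (Omega L H z) g"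
      using mesh_constant_measurable[OF g] unfolding set_borel_measurable_def Omega_def by measurable
    moreover have "g x = g c" if "c \<in> cell_corners L H h z" "x \<in> cell h c" for x c
      using mesh_constant_eq_on_cell[OF g that] .
    ultimately show ?thesis
      by (subst integral_Omega_eq_sum)
        (auto intro!: set_integral_cell_const sum.cong)
  qed
  show ?thesis
    unfolding eq[OF mesh_convergesD(1)[OF assms]] eq[OF mesh_convergesD(2)[OF assms]]
    by (intro tendsto_intros mesh_convergesD(3)[OF assms])
qed

text \<open>
  The field \<open>g\<close> is not constant on cells.  On each cell the piecewise constant factors can be taken out of
  the integral, which leaves weights that do not depend on the sequence.
\<close>

lemma tendsto_gravity:
  fixes g :: "real ^ 'd \<Rightarrow> real ^ 'd"
  assumes R: "mesh_converges R \<rho>" and \<phi>: "mesh_constant \<phi>"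
    and g: "continuous_on (Omega L H z) g"
  shows "(\<lambda>m. LINT x:Omega L H z|lborel. (R m x *\<^sub>R g x) \<bullet> \<phi> x)
    \<longlonglongrightarrow> (LINT x:Omega L H z|lborel. (\<rho> x *\<^sub>R g x) \<bullet> \<phi> x)"
proof -
  have g_int: "set_integrable lborel (Omega L H z) g"
    unfolding set_integrable_def
    using g by (intro borel_integrable_compact) (auto simp: Omega_def)
  have eq: "(LINT x:Omega L H z|lborel. (r x *\<^sub>R g x) \<bullet> \<phi> x) =
      (\<Sum>c\<in>cell_corners L H h z. r c * (LINT x:cell h c|lborel. g x \<bullet> \<phi> c))" if r: "mesh_constant r" for r
  proof -
    have "(\<lambda>x. (r x *\<^sub>R (indicator (Omega L H z) x *\<^sub>R g x)) \<bullet> \<phi> x) \<in> borel_measurable lborel"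
      using borel_measurable_integrable[OF g_int[unfolded set_integrable_def]]
        mesh_constant_measurable[OF r] mesh_constant_measurable[OF \<phi>]
      by (intro borel_measurable_inner borel_measurable_scaleR[of r]) simp_all
    then have meas: "set_borel_measurable lborel (Omega L H z) (\<lambda>x. (r x *\<^sub>R g x) \<bullet> \<phi> x)"
      by (simp add: set_borel_measurable_def mult_ac)
    have loc: "(r x *\<^sub>R g x) \<bullet> \<phi> x = r c * (g x \<bullet> \<phi> c)"
      if "c \<in> cell_corners L H h z" "x \<in> cell h c" for c x
      using mesh_constant_eq_on_cell[OF r that] mesh_constant_eq_on_cell[OF \<phi> that] by simp
    have "set_integrable lborel (cell h c) (\<lambda>x. (r x *\<^sub>R g x) \<bullet> \<phi> x)"
      if c: "c \<in> cell_corners L H h z" for c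
    proof -
      have "set_integrable lborel (cell h c) g"
        by (rule set_integrable_subset[OF g_int]) (use cell_subset_Omega[OF c] in auto)
      then have "integrable lborel (\<lambda>x. (indicator (cell h c) x *\<^sub>R g x) \<bullet> \<phi> c)"
        unfolding set_integrable_def by (rule integrable_inner_left)
      then have "set_integrable lborel (cell h c) (\<lambda>x. g x \<bullet> \<phi> c)"
        by (simp add: set_integrable_def)
      then have "set_integrable lborel (cell h c) (\<lambda>x. r c * (g x \<bullet> \<phi> c))"
        by (rule set_integrable_mult_right)
      then show ?thesis
        using loc[OF c] by (subst set_integrable_cong[OF refl refl]) auto
    qed
    then have "(LINT x:Omega L H z|lborel. (r x *\<^sub>R g x) \<bullet> \<phi> x) =
        (\<Sum>c\<in>cell_corners L H h z. LINT x:cell h c|lborel. (r x *\<^sub>R g x) \<bullet> \<phi> x)"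
      using meas by (intro integral_Omega_eq_sum)
    also have "\<dots> = (\<Sum>c\<in>cell_corners L H h z. LINT x:cell h c|lborel. r c * (g x \<bullet> \<phi> c))"
      using loc by (intro sum.cong set_lebesgue_integral_cong) auto
    finally show ?thesis by simp
  qed
  show ?thesis
    unfolding eq[OF mesh_convergesD(1)[OF R]] eq[OF mesh_convergesD(2)[OF R]]
    by (intro tendsto_intros mesh_convergesD(3)[OF R])
qed

section \<open>Traces and difference operators\<close>

text \<open>
  The floor function has one-sided limits; on the left of \<open>a\<close> its value is \<open>\<lceil>a\<rceil> - 1\<close>, also
  if \<open>a\<close> is an integer.
\<close>

lemma floor_ray_eventually_const:
  fixes a b :: real
  shows "\<exists>k. \<forall>\<^sub>F \<delta> in at_right 0. \<lfloor>a + \<delta> * b\<rfloor> = k"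
proof -
  have lim: "((\<lambda>\<delta>. a + \<delta> * b) \<longlongrightarrow> a + 0 * b) (at_right 0)"
    by (intro tendsto_intros)
  have pos: "\<forall>\<^sub>F \<delta> in at_right 0. (0::real) < \<delta>"
    by (rule eventually_at_right_less)
  show ?thesis
  proof (cases "b \<ge> 0")
    case True
    have "\<forall>\<^sub>F \<delta> in at_right 0. a + \<delta> * b < of_int \<lfloor>a\<rfloor> + 1"
      using order_tendstoD(2)[OF lim, of "of_int \<lfloor>a\<rfloor> + 1"] by simp
    with pos have "\<forall>\<^sub>F \<delta> in at_right 0. \<lfloor>a + \<delta> * b\<rfloor> = \<lfloor>a\<rfloor>"
    proof eventually_elim
      case (elim \<delta>)
      then have "0 \<le> \<delta> * b" using True by simp
      with elim show ?case by linarith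
    qed
    then show ?thesis by blast
  next
    case False
    have "\<forall>\<^sub>F \<delta> in at_right 0. of_int (\<lceil>a\<rceil> - 1) < a + \<delta> * b"
      using order_tendstoD(1)[OF lim, of "of_int (\<lceil>a\<rceil> - 1)"] by linarith
    with pos have "\<forall>\<^sub>F \<delta> in at_right 0. \<lfloor>a + \<delta> * b\<rfloor> = \<lceil>a\<rceil> - 1"
    proof eventually_elim
      case (elim \<delta>)
      then have "\<delta> * b < 0" using False by (simp add: mult_pos_neg)
      with elim show ?case by linarith
    qed
    then show ?thesis by blast
  qed
qed

lemma ray_enters_cell:
  "\<exists>k. \<forall>\<^sub>F \<delta> in at_right 0. cell_index (x + \<delta> *\<^sub>R n) = k"
proof -
  have "\<exists>k. \<forall>\<^sub>F \<delta> in at_right 0. cell_index (x + \<delta> *\<^sub>R n) i = k" for i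
    using floor_ray_eventually_const[of "(x $ i - lo L H z $ i) / h" "n $ i / h"]
    by (simp add: cell_index_def add_divide_distrib diff_divide_distrib add_diff_eq algebra_simps)
  then obtain k where "\<And>i. \<forall>\<^sub>F \<delta> in at_right 0. cell_index (x + \<delta> *\<^sub>R n) i = k i"
    by metis
  then have "\<forall>\<^sub>F \<delta> in at_right 0. \<forall>i. cell_index (x + \<delta> *\<^sub>R n) i = k i"
    by (intro eventually_all_finite) auto
  then have "\<forall>\<^sub>F \<delta> in at_right 0. cell_index (x + \<delta> *\<^sub>R n) = k"
    by eventually_elim auto
  then show ?thesis by blast
qed

text \<open>
  The point \<open>p\<close> is the same for all \<open>v\<close>: traces are evaluations, and pass to the limit
  under pointwise convergence.
\<close>

lemma Lim_ray_eq_point_value: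
  "\<exists>p. \<forall>v :: real ^ 'd \<Rightarrow> 'b::t2_space.
     mesh_constant v \<longrightarrow> Lim (at_right 0) (\<lambda>\<delta>. v (x + \<delta> *\<^sub>R n)) = v p"
proof -
  obtain k where k: "\<forall>\<^sub>F \<delta> in at_right 0. cell_index (x + \<delta> *\<^sub>R n) = k"
    using ray_enters_cell by blast
  have "Lim (at_right 0) (\<lambda>\<delta>. v (x + \<delta> *\<^sub>R n)) = v (corner k)"
    if v: "mesh_constant v" for v :: "real ^ 'd \<Rightarrow> 'b"
  proof (rule tendsto_Lim)
    show "((\<lambda>\<delta>. v (x + \<delta> *\<^sub>R n)) \<longlongrightarrow> v (corner k)) (at_right 0)"
    proof (rule tendsto_eventually)
      show "\<forall>\<^sub>F \<delta> in at_right 0. v (x + \<delta> *\<^sub>R n) = v (corner k)"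
        using k
      proof eventually_elim
        case (elim \<delta>)
        then have "cell_index (x + \<delta> *\<^sub>R n) = cell_index (corner k)" by simp
        then show ?case using v unfolding mesh_constant_def by blast
      qed
    qed
  qed simp
  then show ?thesis by blast
qed

lemma tendsto_trace_in:
  fixes v :: "real ^ 'd \<Rightarrow> 'b::real_normed_vector"
  assumes "mesh_converges V v"
  shows "(\<lambda>m. trace_in n (V m) x) \<longlonglongrightarrow> trace_in n v x"
proof -
  obtain p where "\<forall>w :: real ^ 'd \<Rightarrow> 'b. mesh_constant w \<longrightarrow>
      Lim (at_right 0) (\<lambda>\<delta>. w (x + \<delta> *\<^sub>R (- n))) = w p"
    using Lim_ray_eq_point_value by blast
  then have "trace_in n w x = w p" if "mesh_constant w" for w :: "real ^ 'd \<Rightarrow> 'b"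
    using that by (simp add: trace_in_def)
  then show ?thesis using mesh_convergesD[OF assms] by simp
qed

lemma tendsto_trace_out:
  fixes v :: "real ^ 'd \<Rightarrow> 'b::real_normed_vector"
  assumes "mesh_converges V v"
  shows "(\<lambda>m. trace_out H z n (V m) x) \<longlonglongrightarrow> trace_out H z n v x"
proof (cases "n $ z * x $ z = H")
  case True
  then show ?thesis
    using tendsto_trace_in[OF assms] by (auto simp: trace_out_def intro!: tendsto_minus)
next
  case False
  obtain p where "\<forall>w :: real ^ 'd \<Rightarrow> 'b. mesh_constant w \<longrightarrow>
      Lim (at_right 0) (\<lambda>\<delta>. w (x + \<delta> *\<^sub>R n)) = w p"
    using Lim_ray_eq_point_value by blast
  then have "trace_out H z n w x = w p" if "mesh_constant w" for w :: "real ^ 'd \<Rightarrow> 'b"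
    using that False by (simp add: trace_out_def)
  then show ?thesis using mesh_convergesD[OF assms] by simp
qed

lemma tendsto_jump:
  "mesh_converges V v \<Longrightarrow> (\<lambda>m. jump H z n (V m) x) \<longlonglongrightarrow> jump H z n v x"
  unfolding jump_def by (intro tendsto_intros tendsto_trace_in tendsto_trace_out)

lemma tendsto_avg:
  "mesh_converges V v \<Longrightarrow> (\<lambda>m. avg H z n (V m) x) \<longlonglongrightarrow> avg H z n v x"
  unfolding avg_def by (intro tendsto_intros tendsto_trace_in tendsto_trace_out)

text \<open>
  The upwind value jumps when the normal velocity \<open>a\<close> changes sign, but its product with \<open>a\<close> is
  \<open>max a 0\<close> times the inner trace plus \<open>min a 0\<close> times the outer one, which is continuous in \<open>a\<close> and
  in the traces.
\<close>

lemma tendsto_flux: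
  fixes r :: "real ^ 'd \<Rightarrow> 'b::real_normed_vector"
  assumes "mesh_converges R r" "mesh_converges U u"
  shows "(\<lambda>m. flux H h z \<alpha> (R m) (U m) n x) \<longlonglongrightarrow> flux H h z \<alpha> r u n x"
proof -
  have "flux H h z \<alpha> r' u' n x =
      max (avg H z n u' x \<bullet> n) 0 *\<^sub>R trace_in n r' x
      + min (avg H z n u' x \<bullet> n) 0 *\<^sub>R trace_out H z n r' x - (h powr \<alpha>) *\<^sub>R jump H z n r' x"
    for r' :: "real ^ 'd \<Rightarrow> 'b" and u'
    by (simp add: flux_def upwind_def max_def min_def)
  then show ?thesis
    using assms
    by (auto intro!: tendsto_intros tendsto_max tendsto_min tendsto_avg tendsto_jump
        tendsto_trace_in tendsto_trace_out)
qed

lemma mesh_constant_sum_cells: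
  "mesh_constant (\<lambda>x. \<Sum>c\<in>cell_corners L H h z. indicat_real (cell h c) x *\<^sub>R a c)"
  unfolding mesh_constant_def
proof (intro allI impI sum.cong refl)
  fix x y :: "real ^ 'd" and c
  assume eq: "cell_index x = cell_index y" and c: "c \<in> cell_corners L H h z"
  have "w \<in> cell h c \<longleftrightarrow> cell_index w = cell_index c" for w
    using mem_cell_corner_iff[of w "cell_index c"] cell_corner_eq[OF c] by simp
  then show "indicat_real (cell h c) x *\<^sub>R a c = indicat_real (cell h c) y *\<^sub>R a c"
    using eq by (simp add: indicator_def)
qed

lemma mesh_constant_grad_h: "mesh_constant (grad_h L H h z v)"
  unfolding grad_h_def by (rule mesh_constant_comp[OF mesh_constant_sum_cells])

lemma mesh_constant_div_h: "mesh_constant (div_h L H h z v)"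
  unfolding div_h_def
  using mesh_constant_comp[OF mesh_constant_sum_cells, of "\<lambda>s. (1 / h) * s"] by simp

lemma mesh_converges_grad_h:
  "mesh_converges V v \<Longrightarrow> mesh_converges (\<lambda>m. grad_h L H h z (V m)) (grad_h L H h z v)"
  unfolding mesh_converges_def[of "\<lambda>m. grad_h L H h z (V m)"]
  by (intro conjI allI mesh_constant_grad_h) (unfold grad_h_def, intro tendsto_intros tendsto_avg)

lemma mesh_converges_div_h:
  "mesh_converges V v \<Longrightarrow> mesh_converges (\<lambda>m. div_h L H h z (V m)) (div_h L H h z v)"
  unfolding mesh_converges_def[of "\<lambda>m. div_h L H h z (V m)"]
  by (intro conjI allI mesh_constant_div_h) (unfold div_h_def, intro tendsto_intros tendsto_avg)

lemma mesh_converges_Grad_h: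
  "mesh_converges V v \<Longrightarrow> mesh_converges (\<lambda>m. Grad_h L H h z (V m)) (Grad_h L H h z v)"
  unfolding Grad_h_def
  by (intro mesh_converges_vec mesh_converges_grad_h mesh_converges_linear[OF _ bounded_linear_vec_nth])

lemma bounded_linear_transpose: "bounded_linear (transpose :: real ^ 'd ^ 'd \<Rightarrow> real ^ 'd ^ 'd)"
  by (rule linear_conv_bounded_linear[THEN iffD1]) (auto simp: linear_iff transpose_def vec_eq_iff)

lemma mesh_converges_D_h:
  "mesh_converges V v \<Longrightarrow> mesh_converges (\<lambda>m. D_h L H h z (V m)) (D_h L H h z v)"
  unfolding D_h_def
  by (intro mesh_converges_scaleR mesh_converges_const mesh_constant_const mesh_converges_add
      mesh_converges_Grad_h mesh_converges_linear[OF _ bounded_linear_transpose])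

lemma mesh_converges_stress:
  assumes "mesh_converges R \<rho>" "mesh_converges V u" "mesh_converges \<Theta> \<theta>"
  shows "mesh_converges (\<lambda>m. stress L H h z \<mu> \<eta> (R m) (V m) (\<Theta> m)) (stress L H h z \<mu> \<eta> \<rho> u \<theta>)"
  unfolding stress_def using assms
  by (intro mesh_converges_scaleR mesh_converges_const mesh_constant_const mesh_converges_add
      mesh_converges_diff mesh_converges_mult mesh_converges_D_h mesh_converges_div_h)

section \<open>Integrals over faces\<close>

text \<open>
  The first component of a face is its lowest corner, which belongs to the face.
\<close>

definition face_constant :: "(real ^ 'd) \<times> 'd \<Rightarrow> (real ^ 'd \<Rightarrow> 'b) \<Rightarrow> bool" where
  "face_constant \<sigma> f \<longleftrightarrow> (\<forall>x\<in>face h \<sigma>. f x = f (fst \<sigma>))"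

lemma face_integral_eq:
  assumes "face_constant (c, j) f"
  shows "face_integral h (c, j) f = (1 / h) * (measure lborel (cell h c) * f c)"
proof -
  have "f (\<chi> i. if i = j then c $ j else x $ i) = f c" if "x \<in> cell h c" for x
  proof -
    have "(\<chi> i. if i = j then c $ j else x $ i) \<in> face h (c, j)"
      using that by (auto simp: face_def cell_def)
    then show ?thesis using assms by (auto simp: face_constant_def)
  qed
  then show ?thesis
    by (simp add: face_integral_def set_integral_cell_const(1))
qed

lemma tendsto_face_integral:
  assumes "\<And>m::nat. face_constant (c, j) (F m)" "face_constant (c, j) f" "(\<lambda>m. F m c) \<longlonglongrightarrow> f c"
  shows "(\<lambda>m. face_integral h (c, j) (F m)) \<longlonglongrightarrow> face_integral h (c, j) f"
  unfolding face_integral_eq[OF assms(1)] face_integral_eq[OF assms(2)]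
  by (intro tendsto_intros assms(3))

text \<open>
  The cells adjacent to a face extend over the whole face, and a shift along the normal changes only the
  coordinate that all points of the face share.
\<close>

lemma face_shift_index:
  assumes "c \<in> grid L H h z" "x \<in> face h (c, j)"
  shows "cell_index (x + (s *\<^sub>R axis j 1)) = cell_index (c + (s *\<^sub>R axis j 1))"
proof
  fix i
  show "cell_index (x + (s *\<^sub>R axis j 1)) i = cell_index (c + (s *\<^sub>R axis j 1)) i"
  proof (cases "i = j")
    case True
    then show ?thesis using assms(2) by (simp add: cell_index_def face_def)
  next
    case False
    obtain k :: int where k: "c $ i = lo L H z $ i + of_int k * h"
      using assms(1) by (auto simp: grid_def)
    have "c $ i \<le> x $ i" "x $ i < c $ i + h" using assms(2) False by (auto simp: face_def)
    then have "\<lfloor>(x $ i - lo L H z $ i) / h\<rfloor> = k"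
      using h_pos k by (simp add: floor_eq_iff field_simps)
    moreover have "\<lfloor>(c $ i - lo L H z $ i) / h\<rfloor> = k"
      using h_pos k by simp
    ultimately show ?thesis using False by (simp add: cell_index_def axis_def)
  qed
qed

text \<open>
  Points of one face are indistinguishable for the mesh after any displacement along the normal, so their
  traces are limits of the same function of the displacement.
\<close>

lemma face_constant_traces:
  assumes v: "mesh_constant v" and c: "c \<in> grid L H h z" and n: "n = axis j 1 \<or> n = - axis j 1"
  shows "face_constant (c, j) (trace_in n v)" "face_constant (c, j) (trace_out H z n v)"
proof -
  have eq: "v (x + \<delta> *\<^sub>R n) = v (c + \<delta> *\<^sub>R n)" if "x \<in> face h (c, j)" for x \<delta>
  proof -
    have "cell_index (x + \<delta> *\<^sub>R n) = cell_index (c + \<delta> *\<^sub>R n)"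
      using face_shift_index[OF c that, of \<delta>] face_shift_index[OF c that, of "- \<delta>"] n
      by auto
    then show ?thesis using v unfolding mesh_constant_def by blast
  qed
  have eq': "v (x - \<delta> *\<^sub>R n) = v (c - \<delta> *\<^sub>R n)" if "x \<in> face h (c, j)" for x \<delta>
    using eq[OF that, of "- \<delta>"] by simp
  show "face_constant (c, j) (trace_in n v)"
    by (simp add: face_constant_def trace_in_def eq')
  moreover have "n $ z * x $ z = n $ z * c $ z" if "x \<in> face h (c, j)" for x
    using that n by (auto simp: face_def axis_def)
  ultimately have "trace_out H z n v x = trace_out H z n v c" if "x \<in> face h (c, j)" for x
    using that by (simp only: trace_out_def eq[OF that]) (simp add: face_constant_def)
  then show "face_constant (c, j) (trace_out H z n v)"
    by (simp add: face_constant_def)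
qed

lemma face_constant_jump:
  assumes v: "mesh_constant v" and c: "c \<in> grid L H h z" and n: "n = axis j 1 \<or> n = - axis j 1"
  shows "face_constant (c, j) (jump H z n v)"
  using face_constant_traces[OF assms] by (simp add: face_constant_def jump_def)

lemma face_constant_flux:
  assumes r: "mesh_constant r" and u: "mesh_constant u"
    and c: "c \<in> grid L H h z" and n: "n = axis j 1 \<or> n = - axis j 1"
  shows "face_constant (c, j) (flux H h z \<alpha> r u n)"
  using face_constant_traces[OF r c n] face_constant_traces[OF u c n]
  by (simp add: face_constant_def flux_def upwind_def avg_def jump_def)

lemma face_constant_comp2:
  "face_constant \<sigma> f \<Longrightarrow> face_constant \<sigma> g \<Longrightarrow> face_constant \<sigma> (\<lambda>x. F (f x) (g x))"
  by (simp add: face_constant_def)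

lemma tendsto_int_face_integral:
  assumes "\<And>m c j. c \<in> grid L H h z \<Longrightarrow> face_constant (c, j) (F m (axis j 1))"
    and "\<And>c j. c \<in> grid L H h z \<Longrightarrow> face_constant (c, j) (f (axis j 1))"
    and "\<And>n x. (\<lambda>m::nat. F m n x) \<longlonglongrightarrow> f n x"
  shows "(\<lambda>m. int_face_integral L H h z (F m)) \<longlonglongrightarrow> int_face_integral L H h z f"
  unfolding int_face_integral_def
proof (intro tendsto_sum, clarify)
  fix c j assume "(c, j) \<in> int_faces L H h z"
  then have "c \<in> grid L H h z" by (simp add: int_faces_def faces_def)
  then show "(\<lambda>m. face_integral h (c, j) (F m (axis j 1))) \<longlonglongrightarrow> face_integral h (c, j) (f (axis j 1))"
    by (intro tendsto_face_integral assms)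
qed

text \<open>
  Constancy on the face is asked for both normals because the orientation depends on the
  component of the boundary.
\<close>

lemma tendsto_ext_face_integral:
  assumes "\<And>m c n. (c, z) \<in> ext_faces L H h z \<Longrightarrow> n = axis z 1 \<or> n = - axis z 1 \<Longrightarrow> face_constant (c, z) (F m n)"
    and "\<And>c n. (c, z) \<in> ext_faces L H h z \<Longrightarrow> n = axis z 1 \<or> n = - axis z 1 \<Longrightarrow> face_constant (c, z) (f n)"
    and "\<And>n x. (\<lambda>m::nat. F m n x) \<longlonglongrightarrow> f n x"
  shows "(\<lambda>m. ext_face_integral L H h z (F m)) \<longlonglongrightarrow> ext_face_integral L H h z f"
  unfolding ext_face_integral_def
proof (intro tendsto_sum, clarify)
  fix c j assume cj: "(c, j) \<in> ext_faces L H h z"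
  then have j: "j = z" and "\<bar>c $ z\<bar> = H" by (auto simp: ext_faces_def)
  then have "outer_normal z c = axis z 1 \<or> outer_normal z c = - axis z 1"
    using H_pos by (auto simp: outer_normal_def sgn_if)
  then show "(\<lambda>m. face_integral h (c, j) (F m (outer_normal z c)))
      \<longlonglongrightarrow> face_integral h (c, j) (f (outer_normal z c))"
    using cj unfolding j by (intro tendsto_face_integral assms)
qed

section \<open>Stability of the scheme under pointwise limits\<close>

lemma continuity_eq_limit:
  assumes R0: "mesh_converges R0 \<rho>0" and R: "mesh_converges R \<rho>" and V: "mesh_converges V u"
    and eq: "\<forall>\<^sub>F m in sequentially. continuity_eq L H h z dt \<alpha> (R0 m) (R m) (V m)"
  shows "continuity_eq L H h z dt \<alpha> \<rho>0 \<rho> u"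
  unfolding continuity_eq_def
proof
  fix \<phi> :: "real ^ 'd \<Rightarrow> real" assume \<phi>: "\<phi> \<in> Qh L H h z"
  note phi = Qh_mesh_constant[OF \<phi>]
  define lhs where "lhs r0 r w = (LINT x:Omega L H z|lborel. (r x - r0 x) / dt * \<phi> x)
     - int_face_integral L H h z (\<lambda>n x. flux H h z \<alpha> r w n x * jump H z n \<phi> x)" for r0 r w
  have "mesh_converges (\<lambda>m x. (R m x - R0 m x) / dt * \<phi> x) (\<lambda>x. (\<rho> x - \<rho>0 x) / dt * \<phi> x)"
    by (intro mesh_converges_mult mesh_converges_linear[OF _ bounded_linear_divide] mesh_converges_diff
        mesh_converges_const phi R R0)
  then have "(\<lambda>m. LINT x:Omega L H z|lborel. (R m x - R0 m x) / dt * \<phi> x)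
      \<longlonglongrightarrow> (LINT x:Omega L H z|lborel. (\<rho> x - \<rho>0 x) / dt * \<phi> x)"
    by (rule tendsto_integral_Omega)
  moreover have "(\<lambda>m. int_face_integral L H h z (\<lambda>n x. flux H h z \<alpha> (R m) (V m) n x * jump H z n \<phi> x))
      \<longlonglongrightarrow> int_face_integral L H h z (\<lambda>n x. flux H h z \<alpha> \<rho> u n x * jump H z n \<phi> x)"
    by (intro tendsto_int_face_integral face_constant_comp2[where F = "(*)"] tendsto_mult tendsto_const
        face_constant_flux face_constant_jump tendsto_flux mesh_convergesD[OF R] mesh_convergesD[OF V] R V phi) auto
  ultimately have lim: "(\<lambda>m. lhs (R0 m) (R m) (V m)) \<longlonglongrightarrow> lhs \<rho>0 \<rho> u"
    unfolding lhs_def by (intro tendsto_diff)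
  have "\<forall>\<^sub>F m in sequentially. lhs (R0 m) (R m) (V m) = 0"
    using eq by eventually_elim (use \<phi> in \<open>auto simp: lhs_def continuity_eq_def\<close>)
  from LIMSEQ_unique[OF lim tendsto_eventually[OF this]] 
  show "(LINT x:Omega L H z|lborel. (\<rho> x - \<rho>0 x) / dt * \<phi> x)
     - int_face_integral L H h z (\<lambda>n x. flux H h z \<alpha> \<rho> u n x * jump H z n \<phi> x) = 0"
    by (simp add: lhs_def)
qed

lemma momentum_eq_limit:
  assumes R0: "mesh_converges R0 \<rho>0" and V0: "mesh_converges V0 u0"
    and R: "mesh_converges R \<rho>" and V: "mesh_converges V u" and \<Theta>: "mesh_converges \<Theta> \<theta>"
    and g: "continuous_on (Omega L H z) (gradient H z G)"
    and eq: "\<forall>\<^sub>F m in sequentially. momentum_eq L H h z dt \<alpha> \<mu> \<eta> G (R0 m) (V0 m) (R m) (V m) (\<Theta> m)"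
  shows "momentum_eq L H h z dt \<alpha> \<mu> \<eta> G \<rho>0 u0 \<rho> u \<theta>"
  unfolding momentum_eq_def
proof
  fix \<phi> :: "real ^ 'd \<Rightarrow> real ^ 'd" assume \<phi>: "\<phi> \<in> Qh L H h z"
  note phi = Qh_mesh_constant[OF \<phi>]
  define lhs where "lhs r0 w0 r w th =
     (LINT x:Omega L H z|lborel. ((1 / dt) *\<^sub>R (r x *\<^sub>R w x - r0 x *\<^sub>R w0 x)) \<bullet> \<phi> x)
     - int_face_integral L H h z
         (\<lambda>n x. flux H h z \<alpha> (\<lambda>y. r y *\<^sub>R w y) w n x \<bullet> jump H z n \<phi> x)
     + (LINT x:Omega L H z|lborel. stress L H h z \<mu> \<eta> r w th x \<bullet> D_h L H h z \<phi> x)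
     - (LINT x:Omega L H z|lborel. (r x *\<^sub>R gradient H z G x) \<bullet> \<phi> x)" for r0 w0 r w th
  note RV = mesh_converges_scaleR[OF R V]
  have "mesh_converges (\<lambda>m x. ((1 / dt) *\<^sub>R (R m x *\<^sub>R V m x - R0 m x *\<^sub>R V0 m x)) \<bullet> \<phi> x)
      (\<lambda>x. ((1 / dt) *\<^sub>R (\<rho> x *\<^sub>R u x - \<rho>0 x *\<^sub>R u0 x)) \<bullet> \<phi> x)"
    by (intro mesh_converges_inner mesh_converges_scaleR mesh_converges_diff
        mesh_converges_const mesh_constant_const phi R R0 V V0)
  then have 1: "(\<lambda>m. LINT x:Omega L H z|lborel. ((1 / dt) *\<^sub>R (R m x *\<^sub>R V m x - R0 m x *\<^sub>R V0 m x)) \<bullet> \<phi> x)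
      \<longlonglongrightarrow> (LINT x:Omega L H z|lborel. ((1 / dt) *\<^sub>R (\<rho> x *\<^sub>R u x - \<rho>0 x *\<^sub>R u0 x)) \<bullet> \<phi> x)"
    by (rule tendsto_integral_Omega)
  have 2: "(\<lambda>m. int_face_integral L H h z (\<lambda>n x. flux H h z \<alpha> (\<lambda>y. R m y *\<^sub>R V m y) (V m) n x \<bullet> jump H z n \<phi> x))
      \<longlonglongrightarrow> int_face_integral L H h z (\<lambda>n x. flux H h z \<alpha> (\<lambda>y. \<rho> y *\<^sub>R u y) u n x \<bullet> jump H z n \<phi> x)"
    by (intro tendsto_int_face_integral face_constant_comp2[where F = "inner"] tendsto_inner tendsto_const
        face_constant_flux face_constant_jump tendsto_flux mesh_convergesD[OF RV] mesh_convergesD[OF V] RV V phi) auto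
  have "mesh_converges (\<lambda>m x. stress L H h z \<mu> \<eta> (R m) (V m) (\<Theta> m) x \<bullet> D_h L H h z \<phi> x)
      (\<lambda>x. stress L H h z \<mu> \<eta> \<rho> u \<theta> x \<bullet> D_h L H h z \<phi> x)"
    by (intro mesh_converges_inner mesh_converges_stress mesh_converges_D_h mesh_converges_const R V \<Theta> phi)
  then have 3: "(\<lambda>m. LINT x:Omega L H z|lborel. stress L H h z \<mu> \<eta> (R m) (V m) (\<Theta> m) x \<bullet> D_h L H h z \<phi> x)
      \<longlonglongrightarrow> (LINT x:Omega L H z|lborel. stress L H h z \<mu> \<eta> \<rho> u \<theta> x \<bullet> D_h L H h z \<phi> x)"
    by (rule tendsto_integral_Omega)
  have lim: "(\<lambda>m. lhs (R0 m) (V0 m) (R m) (V m) (\<Theta> m)) \<longlonglongrightarrow> lhs \<rho>0 u0 \<rho> u \<theta>"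
    unfolding lhs_def by (intro tendsto_diff tendsto_add 1 2 3 tendsto_gravity[OF R phi g])
  have "\<forall>\<^sub>F m in sequentially. lhs (R0 m) (V0 m) (R m) (V m) (\<Theta> m) = 0"
    using eq by eventually_elim (use \<phi> in \<open>auto simp: lhs_def momentum_eq_def\<close>)
  from LIMSEQ_unique[OF lim tendsto_eventually[OF this]] 
  show "(LINT x:Omega L H z|lborel. ((1 / dt) *\<^sub>R (\<rho> x *\<^sub>R u x - \<rho>0 x *\<^sub>R u0 x)) \<bullet> \<phi> x)
     - int_face_integral L H h z
         (\<lambda>n x. flux H h z \<alpha> (\<lambda>y. \<rho> y *\<^sub>R u y) u n x \<bullet> jump H z n \<phi> x)
     + (LINT x:Omega L H z|lborel. stress L H h z \<mu> \<eta> \<rho> u \<theta> x \<bullet> D_h L H h z \<phi> x)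
     = (LINT x:Omega L H z|lborel. (\<rho> x *\<^sub>R gradient H z G x) \<bullet> \<phi> x)"
    by (simp add: lhs_def)
qed

lemma energy_eq_limit:
  assumes R0: "mesh_converges R0 \<rho>0" and \<Theta>0: "mesh_converges \<Theta>0 \<theta>0"
    and R: "mesh_converges R \<rho>" and V: "mesh_converges V u" and \<Theta>: "mesh_converges \<Theta> \<theta>"
    and \<theta>B: "\<forall>\<sigma>\<in>ext_faces L H h z. \<theta>B constant_on face h \<sigma>"
    and eq: "\<forall>\<^sub>F m in sequentially. energy_eq L H h z dt \<alpha> \<mu> \<eta> \<kappa> \<gamma> \<theta>B (R0 m) (\<Theta>0 m) (R m) (V m) (\<Theta> m)"
  shows "energy_eq L H h z dt \<alpha> \<mu> \<eta> \<kappa> \<gamma> \<theta>B \<rho>0 \<theta>0 \<rho> u \<theta>"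
  unfolding energy_eq_def Let_def
proof
  fix \<phi> :: "real ^ 'd \<Rightarrow> real" assume \<phi>: "\<phi> \<in> Qh L H h z"
  note phi = Qh_mesh_constant[OF \<phi>]
  define lhs where "lhs r0 th0 r w th =
     1 / (\<gamma> - 1) * (LINT x:Omega L H z|lborel. (r x * th x - r0 x * th0 x) / dt * \<phi> x)
     - 1 / (\<gamma> - 1) * int_face_integral L H h z
         (\<lambda>n x. flux H h z \<alpha> (\<lambda>y. r y * th y) w n x * jump H z n \<phi> x)
     + int_face_integral L H h z (\<lambda>n x. \<kappa> / h * jump H z n th x * jump H z n \<phi> x)
     + 2 * ext_face_integral L H h z
         (\<lambda>n x. \<kappa> / h * (trace_in n th x - \<theta>B x) * trace_in n \<phi> x)
     - (LINT x:Omega L H z|lborel. (stress L H h z \<mu> \<eta> r w th x \<bullet> Grad_h L H h z w x) * \<phi> x)"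
    for r0 th0 r w th
  note RT = mesh_converges_mult[OF R \<Theta>]
  have "mesh_converges (\<lambda>m x. (R m x * \<Theta> m x - R0 m x * \<Theta>0 m x) / dt * \<phi> x)
      (\<lambda>x. (\<rho> x * \<theta> x - \<rho>0 x * \<theta>0 x) / dt * \<phi> x)"
    by (intro mesh_converges_mult mesh_converges_linear[OF _ bounded_linear_divide] mesh_converges_diff
        mesh_converges_const phi R R0 \<Theta> \<Theta>0)
  then have 1: "(\<lambda>m. LINT x:Omega L H z|lborel. (R m x * \<Theta> m x - R0 m x * \<Theta>0 m x) / dt * \<phi> x)
      \<longlonglongrightarrow> (LINT x:Omega L H z|lborel. (\<rho> x * \<theta> x - \<rho>0 x * \<theta>0 x) / dt * \<phi> x)"
    by (rule tendsto_integral_Omega)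
  have 2: "(\<lambda>m. int_face_integral L H h z (\<lambda>n x. flux H h z \<alpha> (\<lambda>y. R m y * \<Theta> m y) (V m) n x * jump H z n \<phi> x))
      \<longlonglongrightarrow> int_face_integral L H h z (\<lambda>n x. flux H h z \<alpha> (\<lambda>y. \<rho> y * \<theta> y) u n x * jump H z n \<phi> x)"
    by (intro tendsto_int_face_integral face_constant_comp2[where F = "(*)"] tendsto_mult tendsto_const
        face_constant_flux face_constant_jump tendsto_flux mesh_convergesD[OF RT] mesh_convergesD[OF V] RT V phi) auto
  have 3: "(\<lambda>m. int_face_integral L H h z (\<lambda>n x. \<kappa> / h * jump H z n (\<Theta> m) x * jump H z n \<phi> x))
      \<longlonglongrightarrow> int_face_integral L H h z (\<lambda>n x. \<kappa> / h * jump H z n \<theta> x * jump H z n \<phi> x)"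
    by (intro tendsto_int_face_integral face_constant_comp2[where F = "\<lambda>a b. \<kappa> / h * a * b"] tendsto_mult tendsto_const
        face_constant_jump tendsto_jump mesh_convergesD[OF \<Theta>] \<Theta> phi) auto
  have 4: "(\<lambda>m. ext_face_integral L H h z (\<lambda>n x. \<kappa> / h * (trace_in n (\<Theta> m) x - \<theta>B x) * trace_in n \<phi> x))
      \<longlonglongrightarrow> ext_face_integral L H h z (\<lambda>n x. \<kappa> / h * (trace_in n \<theta> x - \<theta>B x) * trace_in n \<phi> x)"
  proof (rule tendsto_ext_face_integral)
    have const: "face_constant (c, z) (\<lambda>x. \<kappa> / h * (trace_in n th x - \<theta>B x) * trace_in n \<phi> x)"
      if "(c, z) \<in> ext_faces L H h z" "n = axis z 1 \<or> n = - axis z 1" "mesh_constant th" for c n th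
    proof -
      have c: "c \<in> grid L H h z" using that(1) by (simp add: ext_faces_def faces_def)
      have "c \<in> face h (c, z)" using h_pos by (simp add: face_def)
      then have "face_constant (c, z) \<theta>B"
        using \<theta>B that(1) by (auto simp: face_constant_def constant_on_def)
      then show ?thesis
        using face_constant_traces(1)[OF that(3) c that(2)] face_constant_traces(1)[OF phi c that(2)]
        by (simp add: face_constant_def)
    qed
    show "face_constant (c, z) (\<lambda>x. \<kappa> / h * (trace_in n (\<Theta> m) x - \<theta>B x) * trace_in n \<phi> x)"
      if "(c, z) \<in> ext_faces L H h z" "n = axis z 1 \<or> n = - axis z 1" for m c n
      by (rule const[OF that mesh_convergesD(1)[OF \<Theta>]])
    show "face_constant (c, z) (\<lambda>x. \<kappa> / h * (trace_in n \<theta> x - \<theta>B x) * trace_in n \<phi> x)"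
      if "(c, z) \<in> ext_faces L H h z" "n = axis z 1 \<or> n = - axis z 1" for c n
      by (rule const[OF that mesh_convergesD(2)[OF \<Theta>]])
    show "(\<lambda>m. \<kappa> / h * (trace_in n (\<Theta> m) x - \<theta>B x) * trace_in n \<phi> x)
       \<longlonglongrightarrow> \<kappa> / h * (trace_in n \<theta> x - \<theta>B x) * trace_in n \<phi> x" for n x
      by (intro tendsto_mult tendsto_diff tendsto_const tendsto_trace_in \<Theta>)
  qed
  have "mesh_converges (\<lambda>m x. (stress L H h z \<mu> \<eta> (R m) (V m) (\<Theta> m) x \<bullet> Grad_h L H h z (V m) x) * \<phi> x)
      (\<lambda>x. (stress L H h z \<mu> \<eta> \<rho> u \<theta> x \<bullet> Grad_h L H h z u x) * \<phi> x)"
    by (intro mesh_converges_mult mesh_converges_inner mesh_converges_stress mesh_converges_Grad_h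
        mesh_converges_const R V \<Theta> phi)
  then have 5: "(\<lambda>m. LINT x:Omega L H z|lborel. (stress L H h z \<mu> \<eta> (R m) (V m) (\<Theta> m) x \<bullet> Grad_h L H h z (V m) x) * \<phi> x)
      \<longlonglongrightarrow> (LINT x:Omega L H z|lborel. (stress L H h z \<mu> \<eta> \<rho> u \<theta> x \<bullet> Grad_h L H h z u x) * \<phi> x)"
    by (rule tendsto_integral_Omega)
  have lim: "(\<lambda>m. lhs (R0 m) (\<Theta>0 m) (R m) (V m) (\<Theta> m)) \<longlonglongrightarrow> lhs \<rho>0 \<theta>0 \<rho> u \<theta>"
    unfolding lhs_def by (intro tendsto_diff tendsto_add tendsto_mult tendsto_const 1 2 3 4 5)
  have "\<forall>\<^sub>F m in sequentially. lhs (R0 m) (\<Theta>0 m) (R m) (V m) (\<Theta> m) = 0"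
    using eq by eventually_elim (use \<phi> in \<open>auto simp: lhs_def energy_eq_def Let_def\<close>)
  from LIMSEQ_unique[OF lim tendsto_eventually[OF this]] 
  show "1 / (\<gamma> - 1) * (LINT x:Omega L H z|lborel. (\<rho> x * \<theta> x - \<rho>0 x * \<theta>0 x) / dt * \<phi> x)
     - 1 / (\<gamma> - 1) * int_face_integral L H h z
         (\<lambda>n x. flux H h z \<alpha> (\<lambda>y. \<rho> y * \<theta> y) u n x * jump H z n \<phi> x)
     + int_face_integral L H h z (\<lambda>n x. \<kappa> / h * jump H z n \<theta> x * jump H z n \<phi> x)
     + 2 * ext_face_integral L H h z
         (\<lambda>n x. \<kappa> / h * (trace_in n \<theta> x - \<theta>B x) * trace_in n \<phi> x)
     = (LINT x:Omega L H z|lborel. (stress L H h z \<mu> \<eta> \<rho> u \<theta> x \<bullet> Grad_h L H h z u x) * \<phi> x)"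
    by (simp add: lhs_def)
qed

text \<open>
  It suffices that the equations hold for all late members of the sequence: in the application a
  given pair of nodes lies in the time domain of the solutions only eventually.
\<close>

lemma scheme_step_limit:
  fixes v0 v :: "real ^ 'd \<Rightarrow> real \<times> (real ^ 'd) \<times> real"
  assumes V0: "mesh_converges V0 v0" and V: "mesh_converges V v"
    and g: "continuous_on (Omega L H z) (gradient H z G)"
    and \<theta>B: "\<forall>\<sigma>\<in>ext_faces L H h z. \<theta>B constant_on face h \<sigma>"
    and step: "\<forall>\<^sub>F m in sequentially. scheme_step L H h z dt \<alpha> \<mu> \<eta> \<kappa> \<gamma> G \<theta>B (V0 m) (V m)"
  shows "scheme_step L H h z dt \<alpha> \<mu> \<eta> \<kappa> \<gamma> G \<theta>B v0 v"
proof -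
  have comps: "mesh_converges (\<lambda>m x. fst (W m x)) (\<lambda>x. fst (w x))"
    "mesh_converges (\<lambda>m x. fst (snd (W m x))) (\<lambda>x. fst (snd (w x)))"
    "mesh_converges (\<lambda>m x. snd (snd (W m x))) (\<lambda>x. snd (snd (w x)))"
    if "mesh_converges W w" for W and w :: "real ^ 'd \<Rightarrow> real \<times> (real ^ 'd) \<times> real"
  proof -
    note snd = mesh_converges_linear[OF that bounded_linear_snd]
    show "mesh_converges (\<lambda>m x. fst (W m x)) (\<lambda>x. fst (w x))"
      "mesh_converges (\<lambda>m x. fst (snd (W m x))) (\<lambda>x. fst (snd (w x)))"
      "mesh_converges (\<lambda>m x. snd (snd (W m x))) (\<lambda>x. snd (snd (w x)))"
      by (rule mesh_converges_linear[OF that bounded_linear_fst]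
          mesh_converges_linear[OF snd bounded_linear_fst]
          mesh_converges_linear[OF snd bounded_linear_snd])+
  qed
  show ?thesis
    unfolding scheme_step_def Let_def
  proof (intro conjI)
    show "continuity_eq L H h z dt \<alpha> (\<lambda>x. fst (v0 x)) (\<lambda>x. fst (v x)) (\<lambda>x. fst (snd (v x)))"
      by (rule continuity_eq_limit[OF comps(1)[OF V0] comps(1,2)[OF V]])
        (use step in \<open>eventually_elim, simp add: scheme_step_def Let_def\<close>)
    show "momentum_eq L H h z dt \<alpha> \<mu> \<eta> G (\<lambda>x. fst (v0 x)) (\<lambda>x. fst (snd (v0 x)))
        (\<lambda>x. fst (v x)) (\<lambda>x. fst (snd (v x))) (\<lambda>x. snd (snd (v x)))"
      by (rule momentum_eq_limit[OF comps(1,2)[OF V0] comps[OF V] g])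
        (use step in \<open>eventually_elim, simp add: scheme_step_def Let_def\<close>)
    show "energy_eq L H h z dt \<alpha> \<mu> \<eta> \<kappa> \<gamma> \<theta>B (\<lambda>x. fst (v0 x)) (\<lambda>x. snd (snd (v0 x)))
        (\<lambda>x. fst (v x)) (\<lambda>x. fst (snd (v x))) (\<lambda>x. snd (snd (v x)))"
      by (rule energy_eq_limit[OF comps(1,3)[OF V0] comps[OF V] \<theta>B])
        (use step in \<open>eventually_elim, simp add: scheme_step_def Let_def\<close>)
  qed
qed

section \<open>Extraction of an entire solution\<close>

lemma entire_solution_subsequence:
  fixes T :: "nat \<Rightarrow> real" and U :: "nat \<Rightarrow> real \<Rightarrow> real ^ 'd \<Rightarrow> real \<times> (real ^ 'd) \<times> real"
  assumes dt: "dt > 0"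
    and g: "continuous_on (Omega L H z) (gradient H z G)"
    and \<theta>B: "\<forall>\<sigma>\<in>ext_faces L H h z. \<theta>B constant_on face h \<sigma>"
    and T: "filterlim T at_bot sequentially"
    and sol: "\<And>n. discrete_solution L H h z dt \<alpha> \<mu> \<eta> \<kappa> \<gamma> G \<theta>B (T n) (U n)"
    and B: "B > 0" "\<And>n t. t \<ge> T n \<Longrightarrow> AE x\<in>Omega L H z in lborel. norm (U n t x) \<le> B"
  shows "\<exists>r Uinf. strict_mono (r :: nat \<Rightarrow> nat) \<and>
           entire_discrete_solution L H h z dt \<alpha> \<mu> \<eta> \<kappa> \<gamma> G \<theta>B Uinf \<and>
           (\<forall>a b. uniform_limit ({a..b} \<times> Omega L H z)
              (\<lambda>m (t, x). U (r m) t x) (\<lambda>(t, x). Uinf t x) sequentially)"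
proof -
  let ?step = "scheme_step L H h z dt \<alpha> \<mu> \<eta> \<kappa> \<gamma> G \<theta>B"
  \<comment> \<open>Numbering the nodes of \<open>U n\<close> from \<open>M n\<close>, so that the node \<open>k\<close> is the time \<open>\<tau> n + k * dt\<close>,
    aligns the grids of all solutions up to shifts smaller than \<open>dt\<close>.  Before the initial time of
    \<open>U n\<close> the nodal values are set to zero; the bound \<open>B\<close> then holds at every node.\<close>
  define M where "M n = \<lfloor>T n / dt\<rfloor>" for n
  define \<tau> where "\<tau> n = T n - of_int (M n) * dt" for n
  define W where "W n k = (if M n \<le> k then U n (T n + of_int (k - M n) * dt) else (\<lambda>_. 0))" for n k
  have node: "U n (T n + of_int (k - M n) * dt) \<in> Qh L H h z"
    "?step (U n (T n + of_int (k - M n) * dt)) (U n (T n + of_int (k + 1 - M n) * dt))"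
    if "M n \<le> k" for n k
  proof -
    have k: "of_int (k - M n) = real (nat (k - M n))" "of_int (k + 1 - M n) = real (Suc (nat (k - M n)))"
      using that by auto
    show "U n (T n + of_int (k - M n) * dt) \<in> Qh L H h z"
      "?step (U n (T n + of_int (k - M n) * dt)) (U n (T n + of_int (k + 1 - M n) * dt))"
      using sol[of n] unfolding discrete_solution_def k by blast+
  qed
  have W_Qh: "W n k \<in> Qh L H h z" for n k
    using node(1) by (simp add: W_def Qh_zero)
  have W_step: "?step (W n k) (W n (k + 1))" if "M n \<le> k" for n k
    using node(2)[OF that] that by (simp add: W_def)
  have W_bound: "norm (W n k x) \<le> B" for n k x
  proof (cases "M n \<le> k")
    case True
    have "norm (U n (T n + of_int (k - M n) * dt) c) \<le> B" if "c \<in> cell_corners L H h z" for c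
      using dt True by (intro Qh_AE_imp_corner[OF node(1)[OF True] B(2) that]) simp
    then show ?thesis
      using True B(1) Qh_bound[OF node(1)[OF True]] by (simp add: W_def)
  qed (use B(1) in \<open>simp add: W_def\<close>)
  have U_eq: "U n t x = interpolate (\<lambda>k. W n k x) ((t - \<tau> n) / dt)" if "T n \<le> t" for n t x
  proof -
    let ?s = "(t - T n) / dt"
    have s: "?s + of_int (M n) = (t - \<tau> n) / dt"
      using dt by (simp add: \<tau>_def field_simps)
    have "\<lfloor>?s\<rfloor> \<ge> 0" using that dt by simp
    then have "interpolate (\<lambda>k. U n (T n + of_int k * dt) x) ?s = interpolate (\<lambda>k. W n (k + M n) x) ?s"
      by (simp add: interpolate_def W_def)
    also have "\<dots> = interpolate (\<lambda>k. W n k x) ((t - \<tau> n) / dt)"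
      by (simp only: interpolate_shift[where w = "\<lambda>k. W n k x"] s)
    finally show ?thesis
      using discrete_solution_eq_interpolate[OF sol dt that] by simp
  qed

  have \<tau>_bound: "0 \<le> \<tau> n" "\<tau> n \<le> dt" for n
  proof -
    have "of_int (M n) \<le> T n / dt" "T n / dt \<le> of_int (M n) + 1"
      unfolding M_def by linarith+
    then show "0 \<le> \<tau> n" "\<tau> n \<le> dt"
      using dt by (simp_all add: \<tau>_def field_simps)
  qed
  \<comment> \<open>Each entry of the sequence is paired with its offset, so that one extraction gives the
    convergence of the nodal values and of the offsets.\<close>
  define S where "S = (UNIV :: int set) \<times> cell_corners L H h z"
  have "countable S"
    using finite_cell_corners by (auto simp: S_def intro: countable_finite)
  have joint_bound: "norm (\<tau> n, W n (fst p) (snd p)) \<le> dt + B" for n p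
    using norm_Pair_le[of "\<tau> n" "W n (fst p) (snd p)"] \<tau>_bound[of n] W_bound[of n "fst p" "snd p"]
    by simp
  obtain r :: "nat \<Rightarrow> nat" where r: "strict_mono r"
    and conv: "\<And>p. p \<in> S \<Longrightarrow> \<exists>l. (\<lambda>m. (\<tau> (r m), W (r m) (fst p) (snd p))) \<longlonglongrightarrow> l"
    by (rule function_convergent_subsequence[OF \<open>countable S\<close>,
          where f = "\<lambda>n p. (\<tau> n, W n (fst p) (snd p))"]) (rule joint_bound, blast)
  have "(0, corner (\<lambda>_. 0)) \<in> S"
    using cell_count(2) by (simp add: S_def corner_in_cell_corners_iff)
  then obtain l0 where l0: "(\<lambda>m. (\<tau> (r m), W (r m) 0 (corner (\<lambda>_. 0)))) \<longlonglongrightarrow> l0"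
    using conv by fastforce
  define \<tau>' where "\<tau>' = fst l0"
  have \<tau>': "(\<lambda>m. \<tau> (r m)) \<longlonglongrightarrow> \<tau>'"
    using tendsto_fst[OF l0] by (simp add: \<tau>'_def)
  have conv_corner: "\<exists>l. (\<lambda>m. W (r m) k c) \<longlonglongrightarrow> l" if "c \<in> cell_corners L H h z" for k c
  proof -
    have "(k, c) \<in> S" using that by (simp add: S_def)
    then obtain l where "(\<lambda>m. (\<tau> (r m), W (r m) k c)) \<longlonglongrightarrow> l"
      using conv by fastforce
    then show ?thesis using tendsto_snd by fastforce
  qed
  have "\<exists>l. (\<lambda>m. W (r m) k x) \<longlonglongrightarrow> l" for k x
  proof (cases "in_channel x")
    case True
    then show ?thesis
      using conv_corner[OF home_corner_in_cell_corners[OF True], of k] Qh_eq_home_corner[OF W_Qh True] by simp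
  next
    case False
    then have "(\<lambda>m. W (r m) k x) \<longlonglongrightarrow> 0" using Qh_eq_0[OF W_Qh False] by simp
    then show ?thesis by blast
  qed
  then have "convergent (\<lambda>m. W (r m) k x)" for k x
    by (simp add: convergent_def)
  then obtain V where V: "\<And>k x. (\<lambda>m. W (r m) k x) \<longlonglongrightarrow> V k x"
    using that[of "\<lambda>k x. lim (\<lambda>m. W (r m) k x)"] by (simp add: convergent_LIMSEQ_iff)
  have V_Qh: "V k \<in> Qh L H h z" for k
    using W_Qh V by (rule Qh_limit)
  have V_bound: "norm (V k x) \<le> B" for k x
    by (rule Lim_norm_ubound[OF _ V]) (simp_all add: W_bound)
  have VW: "mesh_converges (\<lambda>m. W (r m) k) (V k)" for k
    unfolding mesh_converges_def by (intro conjI allI V Qh_mesh_constant W_Qh V_Qh)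
  have T_r: "\<forall>\<^sub>F m in sequentially. T (r m) \<le> a" for a
    using filterlim_compose[OF T filterlim_subseq[OF r]] by (simp add: filterlim_at_bot)
  have V_step: "?step (V k) (V (k + 1))" for k
  proof (rule scheme_step_limit[OF VW VW g \<theta>B])
    show "\<forall>\<^sub>F m in sequentially. ?step (W (r m) k) (W (r m) (k + 1))"
      using T_r[of "of_int k * dt"]
    proof eventually_elim
      case (elim m)
      then have "T (r m) / dt \<le> of_int k" using dt by (simp add: field_simps)
      then have "M (r m) \<le> k" by (simp add: M_def floor_le_iff)
      then show ?case by (rule W_step)
    qed
  qed

  define Uinf where "Uinf t x = interpolate (\<lambda>k. V k x) ((t - \<tau>') / dt)" for t x
  have Lip: "norm (Uinf t x - Uinf s x) \<le> 2 * B / dt * \<bar>t - s\<bar>" for t s x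
  proof -
    have "norm (Uinf t x - Uinf s x) \<le> 2 * B * \<bar>(t - \<tau>') / dt - (s - \<tau>') / dt\<bar>"
      unfolding Uinf_def by (rule interpolate_Lipschitz) (rule V_bound)
    also have "(t - \<tau>') / dt - (s - \<tau>') / dt = (t - s) / dt"
      by (simp add: diff_divide_distrib)
    finally show ?thesis using dt by (simp add: abs_divide)
  qed
  have "entire_discrete_solution L H h z dt \<alpha> \<mu> \<eta> \<kappa> \<gamma> G \<theta>B Uinf"
    unfolding entire_discrete_solution_def
  proof (intro conjI allI exI[of _ \<tau>'])
    fix t
    show "Uinf t \<in> Qh L H h z"
      unfolding Uinf_def interpolate_def by (intro Qh_lincomb V_Qh)
    show "uniform_limit (Omega L H z) Uinf (Uinf t) (at t)"
      unfolding uniform_limit_iff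
    proof (intro allI impI)
      fix e :: real assume e: "e > 0"
      have "((\<lambda>s. 2 * B / dt * \<bar>s - t\<bar>) \<longlongrightarrow> 2 * B / dt * \<bar>t - t\<bar>) (at t)"
        by (intro tendsto_intros)
      then have "\<forall>\<^sub>F s in at t. 2 * B / dt * \<bar>s - t\<bar> < e"
        using e by (intro order_tendstoD(2)) auto
      then show "\<forall>\<^sub>F s in at t. \<forall>x\<in>Omega L H z. dist (Uinf s x) (Uinf t x) < e"
      proof eventually_elim
        case (elim s)
        then show ?case using Lip[of s _ t] by (auto simp: dist_norm intro: le_less_trans)
      qed
    qed
    fix n :: nat
    have "Uinf = (\<lambda>t x. interpolate (\<lambda>k. V k x) ((t - \<tau>') / dt))"
      by (intro ext) (rule Uinf_def)
    then have "discrete_solution L H h z dt \<alpha> \<mu> \<eta> \<kappa> \<gamma> G \<theta>B (\<tau>' + of_int (- int n) * dt) Uinf"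
      by (simp only: discrete_solution_interpolate[where W = V, OF dt V_Qh V_step])
    moreover have "\<tau>' + of_int (- int n) * dt = \<tau>' - real n * dt" by simp
    ultimately show "discrete_solution L H h z dt \<alpha> \<mu> \<eta> \<kappa> \<gamma> G \<theta>B (\<tau>' - real n * dt) Uinf"
      by (simp only:)
  qed
  moreover have "uniform_limit ({a..b} \<times> Omega L H z)
      (\<lambda>m (t, x). U (r m) t x) (\<lambda>(t, x). Uinf t x) sequentially" for a b
    unfolding uniform_limit_iff
  proof (intro allI impI)
    fix e :: real assume e: "e > 0"
    \<comment> \<open>The indices of the limit nodes needed to evaluate the limit on \<open>{a..b}\<close>.\<close>
    define I where "I = {\<lfloor>(a - \<tau>') / dt\<rfloor>..\<lfloor>(b - \<tau>') / dt\<rfloor> + 1}"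
    have "(\<lambda>m. 2 * B * \<bar>(\<tau> (r m) - \<tau>') / dt\<bar>) \<longlonglongrightarrow> 2 * B * \<bar>(\<tau>' - \<tau>') / dt\<bar>"
      using dt by (intro tendsto_intros \<tau>') simp
    then have 1: "\<forall>\<^sub>F m in sequentially. 2 * B * \<bar>(\<tau> (r m) - \<tau>') / dt\<bar> < e / 2"
      using e by (intro order_tendstoD(2)) auto
    have "\<forall>\<^sub>F m in sequentially. dist (W (r m) k c) (V k c) < e / 2" for k c
      using V[of k c] e by (intro tendstoD) auto
    then have 2: "\<forall>\<^sub>F m in sequentially. \<forall>k\<in>I. \<forall>c\<in>cell_corners L H h z. dist (W (r m) k c) (V k c) < e / 2"
      by (intro eventually_ball_finite ballI finite_cell_corners) (auto simp: I_def)
    show "\<forall>\<^sub>F m in sequentially. \<forall>p\<in>{a..b} \<times> Omega L H z.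
        dist (case p of (t, x) \<Rightarrow> U (r m) t x) (case p of (t, x) \<Rightarrow> Uinf t x) < e"
      using 1 2 T_r[of a]
    proof eventually_elim
      case (elim m)
      have close: "norm (W (r m) k x - V k x) \<le> e / 2" if "k \<in> I" for k x
      proof (rule Qh_bound[where v = "\<lambda>x. W (r m) k x - V k x"])
        show "(\<lambda>x. W (r m) k x - V k x) \<in> Qh L H h z"
          using Qh_lincomb[OF W_Qh V_Qh, of 1 "r m" k "- 1" k] by simp
        show "norm (W (r m) k c - V k c) \<le> e / 2" if "c \<in> cell_corners L H h z" for c
          using elim(2) \<open>k \<in> I\<close> that by (auto simp: dist_norm less_imp_le)
      qed (use e in simp)
      have "norm (U (r m) t x - Uinf t x) < e" if t: "a \<le> t" "t \<le> b" for t x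
      proof -
        let ?w = "\<lambda>k. W (r m) k x" and ?v = "\<lambda>k. V k x"
        let ?s = "(t - \<tau> (r m)) / dt" and ?s' = "(t - \<tau>') / dt"
        \<comment> \<open>The same nodal values are first moved to the time grid of the limit, and then replaced by
          the limit values.\<close>
        have "U (r m) t x = interpolate ?w ?s"
          using elim(3) t by (intro U_eq) simp
        then have "norm (U (r m) t x - Uinf t x)
            \<le> norm (interpolate ?w ?s - interpolate ?w ?s') + norm (interpolate ?w ?s' - interpolate ?v ?s')"
          using norm_triangle_ineq[of "interpolate ?w ?s - interpolate ?w ?s'" "interpolate ?w ?s' - interpolate ?v ?s'"]
          by (simp add: Uinf_def)
        also have "norm (interpolate ?w ?s - interpolate ?w ?s') \<le> 2 * B * \<bar>?s - ?s'\<bar>"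
          by (rule interpolate_Lipschitz) (rule W_bound)
        also have "?s - ?s' = - ((\<tau> (r m) - \<tau>') / dt)"
          by (simp add: diff_divide_distrib)
        also have "2 * B * \<bar>- ((\<tau> (r m) - \<tau>') / dt)\<bar> < e / 2"
          using elim(1) by simp
        also have "norm (interpolate ?w ?s' - interpolate ?v ?s') \<le> e / 2"
        proof (rule interpolate_diff_bound)
          have "\<lfloor>(a - \<tau>') / dt\<rfloor> \<le> \<lfloor>?s'\<rfloor>" "\<lfloor>?s'\<rfloor> \<le> \<lfloor>(b - \<tau>') / dt\<rfloor>"
            using t dt by (auto intro!: floor_mono divide_right_mono)
          then have "\<lfloor>?s'\<rfloor> \<in> I" "\<lfloor>?s'\<rfloor> + 1 \<in> I" by (auto simp: I_def)
          then show "norm (?w \<lfloor>?s'\<rfloor> - ?v \<lfloor>?s'\<rfloor>) \<le> e / 2"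
            "norm (?w (\<lfloor>?s'\<rfloor> + 1) - ?v (\<lfloor>?s'\<rfloor> + 1)) \<le> e / 2"
            using close by auto
        qed
        finally show ?thesis by simp
      qed
      then show ?case by (auto simp: dist_norm)
    qed
  qed
  ultimately show ?thesis using r by blast
qed

end

theorem theorem3p3:
  fixes L H h dt c1 c2 \<alpha> \<mu> \<eta> \<kappa> \<gamma> :: real
    and z :: "'d::finite"
    and G \<theta>B :: "real ^ 'd \<Rightarrow> real"
    and T :: "nat \<Rightarrow> real"
    and U :: "nat \<Rightarrow> real \<Rightarrow> real ^ 'd \<Rightarrow> real \<times> (real ^ 'd) \<times> real"
    and \<rho>min \<rho>max \<theta>min \<theta>max umax :: real
  assumes "CARD('d) \<in> {2, 3}"
    and "L > 0" "H > 0" "\<gamma> > 1" "\<alpha> > -1"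
    and "C1_potential L H z G" "normal_gradient_constant H z G"
    and "0 < h" "h < 1" "admissible_mesh L H h"
    and "\<forall>\<sigma>\<in>ext_faces L H h z. \<theta>B constant_on face h \<sigma>"
    and "0 < dt" "dt < 1" "0 < c1" "0 < c2" "c1 * h \<le> dt" "dt \<le> c2 * h"
    and "filterlim T at_bot sequentially"
    and "\<forall>n. discrete_solution L H h z dt \<alpha> \<mu> \<eta> \<kappa> \<gamma> G \<theta>B (T n) (U n)"
    and "0 < \<rho>min" "0 < \<rho>max" "0 < \<theta>min" "0 < \<theta>max" "0 < umax"
    and "\<forall>n. \<forall>t\<ge>T n. AE x\<in>Omega L H z in lborel. (case U n t x of (\<rho>, u, \<theta>) \<Rightarrow>
           \<rho>min \<le> \<rho> \<and> \<rho> \<le> \<rho>max \<and> \<theta>min \<le> \<theta> \<and> \<theta> \<le> \<theta>max \<and> norm u \<le> umax)"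
  shows "\<exists>r Uinf. strict_mono (r :: nat \<Rightarrow> nat) \<and>
           entire_discrete_solution L H h z dt \<alpha> \<mu> \<eta> \<kappa> \<gamma> G \<theta>B Uinf \<and>
           (\<forall>a b. uniform_limit ({a..b} \<times> Omega L H z)
              (\<lambda>m (t, x). U (r m) t x) (\<lambda>(t, x). Uinf t x) sequentially)"
proof -
  interpret channel_mesh L H h z
    using assms by unfold_locales
  have "- H \<le> x $ z \<and> x $ z \<le> H" if "x \<in> Omega L H z" for x
    using that by (auto simp: Omega_def mem_box_cart lo_def hi_def dest: spec[of _ z])
  then have "Omega L H z \<subseteq> strip H z" by (auto simp: strip_def)
  then have "continuous_on (Omega L H z) (gradient H z G)"
    using \<open>C1_potential L H z G\<close> continuous_on_subset by (auto simp: C1_potential_def)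
  moreover have "AE x\<in>Omega L H z in lborel. norm (U n t x) \<le> \<rho>max + umax + \<theta>max"
    if "t \<ge> T n" for n t
  proof -
    have bound: "norm p \<le> \<rho>max + umax + \<theta>max"
      if "case p of (\<rho>, u, \<theta>) \<Rightarrow> \<rho>min \<le> \<rho> \<and> \<rho> \<le> \<rho>max \<and> \<theta>min \<le> \<theta> \<and> \<theta> \<le> \<theta>max \<and> norm u \<le> umax"
      for p :: "real \<times> (real ^ 'd) \<times> real"
    proof -
      obtain \<rho> u \<theta> where p: "p = (\<rho>, u, \<theta>)" by (cases p) auto
      have "norm p \<le> \<bar>\<rho>\<bar> + (norm u + \<bar>\<theta>\<bar>)"
        using norm_Pair_le[of \<rho> "(u, \<theta>)"] norm_Pair_le[of u \<theta>] by (simp add: p)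
      then show ?thesis using that \<open>0 < \<rho>min\<close> \<open>0 < \<theta>min\<close> by (simp add: p)
    qed
    show ?thesis
      using assms(25)[rule_format, OF that]
    proof eventually_elim
      case (elim x)
      show ?case by (intro impI bound mp[OF elim])
    qed
  qed
  ultimately show ?thesis
    using assms by (intro entire_solution_subsequence[where B = "\<rho>max + umax + \<theta>max"]) auto
qed

end
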